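(* Let $p>2$. The minimum of $I_p(f)$ over $X_p$ is attained by a function $f_p\in X_p$ satisfying $0\le f_p(r)\le 1$ for all $r\in[0,\infty)$.
   Context: For $p>2$, $$X_p=\Big\{f\in W^{1,p}_{\mathrm{loc}}(0,\infty):\ \int_0^\infty\big(|f'|^2+\tfrac{f^2}{r^2}\big)^{p/2}\,r\,dr<\infty\Big\}$$ (real-valued functions; every $f\in X_p$ has a continuous representative on $[0,\infty)$ with $f(0)=0$), and $$I_p(f)=\int_0^\infty\Big\{\Big[(f')^2+\frac{f^2}{r^2}\Big]^{p/2}+\frac12(1-f^2)^2\Big\}\,r\,dr.$$ *)

theory Defs
  imports "HOL-Analysis.Analysis"
begin

text \<open>Elements of Lebesgue and Sobolev spaces are represented by arbitrary functions
  \<open>real \<Rightarrow> real\<close>; only the almost-everywhere class of their restriction to the open set \<open>S\<close>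
  matters for the notions below.\<close>

definition Lp_loc :: "real set \<Rightarrow> real \<Rightarrow> (real \<Rightarrow> real) \<Rightarrow> bool" where
  "Lp_loc S p f \<longleftrightarrow>
     f \<in> borel_measurable (lebesgue_on S) \<and>
     (\<forall>K. compact K \<and> K \<subseteq> S \<longrightarrow> set_integrable lebesgue K (\<lambda>x. \<bar>f x\<bar> powr p))"

text \<open>The space \<open>C\<^sub>c\<^sup>\<infinity>(S)\<close>, with each function extended by zero to the whole line.\<close>

definition test_fun :: "real set \<Rightarrow> (real \<Rightarrow> real) \<Rightarrow> bool" where
  "test_fun S \<phi> \<longleftrightarrow>
     (\<forall>n x. (deriv ^^ n) \<phi> differentiable (at x)) \<and>
     (\<exists>K. compact K \<and> K \<subseteq> S \<and> (\<forall>x. x \<notin> K \<longrightarrow> \<phi> x = 0))"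

definition has_weak_deriv :: "real set \<Rightarrow> (real \<Rightarrow> real) \<Rightarrow> (real \<Rightarrow> real) \<Rightarrow> bool" where
  "has_weak_deriv S f g \<longleftrightarrow>
     Lp_loc S 1 f \<and> Lp_loc S 1 g \<and>
     (\<forall>\<phi>. test_fun S \<phi> \<longrightarrow>
        (LINT x:S|lebesgue. f x * deriv \<phi> x) = - (LINT x:S|lebesgue. g x * \<phi> x))"

text \<open>Weak derivatives are unique only up to null sets, so this picks some representative;
  it is used below only under integrals.\<close>

definition weak_deriv :: "real set \<Rightarrow> (real \<Rightarrow> real) \<Rightarrow> real \<Rightarrow> real" where
  "weak_deriv S f = (SOME g. has_weak_deriv S f g)"

definition W1p_loc :: "real set \<Rightarrow> real \<Rightarrow> (real \<Rightarrow> real) set" where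
  "W1p_loc S p = {f. Lp_loc S p f \<and> (\<exists>g. has_weak_deriv S f g \<and> Lp_loc S p g)}"

definition grad_density :: "real \<Rightarrow> (real \<Rightarrow> real) \<Rightarrow> real \<Rightarrow> real" where
  "grad_density p f r = ((weak_deriv {0<..} f r)\<^sup>2 + (f r)\<^sup>2 / r\<^sup>2) powr (p / 2)"

definition X :: "real \<Rightarrow> (real \<Rightarrow> real) set" where
  "X p = {f \<in> W1p_loc {0<..} p.
            (\<integral>\<^sup>+ r\<in>{0<..}. ennreal (grad_density p f r * r) \<partial>lebesgue) < \<infinity>}"

text \<open>The potential term need not be integrable for \<open>f \<in> X p\<close> (for instance when \<open>f = 0\<close>),
  so the functional takes values in \<open>[0, \<infinity>]\<close>.\<close>

definition I :: "real \<Rightarrow> (real \<Rightarrow> real) \<Rightarrow> ennreal" where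
  "I p f = (\<integral>\<^sup>+ r\<in>{0<..}.
              ennreal ((grad_density p f r + 1 / 2 * (1 - (f r)\<^sup>2)\<^sup>2) * r) \<partial>lebesgue)"

end

theory Submission
  imports Defs
begin

text \<open>No weak compactness is needed: a minimising sequence converges strongly. With respect to
  \<open>u = f\<^sup>2\<close> the functional is convex, the gradient part because
  \<open>w = sqrt ((f\<^sup>2 + g\<^sup>2) / 2)\<close> satisfies \<open>w'\<^sup>2 \<le> (f'\<^sup>2 + g'\<^sup>2) / 2\<close>, and the potential is quadratic in \<open>u\<close>,
  so the squares of a minimising sequence of nonnegative functions are Cauchy in \<open>L\<^sup>2(r dr)\<close>. Hence
  the potential at the midpoint \<open>(f + g) / 2\<close> is asymptotically no larger than the average of the
  potentials, and Clarkson's inequality for the exponent \<open>p > 2\<close> turns this into the Cauchy property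
  of the gradients in \<open>L\<^sup>p(r dr)\<close>. As \<open>p > 2\<close>, that norm controls \<open>L\<^sup>1(0, b)\<close>, so the derivatives converge
  in \<open>L\<^sup>1(0, b)\<close> and, along a fast sequence, almost everywhere; Fatou's lemma yields the minimiser. The
  bounds \<open>0 \<le> f \<le> 1\<close> come from replacing \<open>f\<close> by \<open>min \<bar>f\<bar> 1\<close>.\<close>

section \<open>The chain rule for absolutely continuous functions\<close>

text \<open>Two competitors are needed because neither suffices alone. The root mean square is the
  right one for the potential, but comparing with it leaves no term in \<open>f' - g'\<close>. The
  midpoint controls the gradients, yet (1 - f^2)^2 is not convex in f. So the first comparison is
  used to make the convexity defect of the second one small. Passing from squares to the midpoint
  rests on (a - b)^2 \<le> |a^2 - b^2|, which needs nonnegative values; therefore the truncation is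
  applied to the minimising sequence and not only to its limit. The variational argument runs on
  pairs of an absolutely continuous function vanishing at 0 and its derivative, since
  \<open>weak_deriv\<close> is a mere choice that cannot be followed through compositions and
  limits. The bridge to \<open>X p\<close> is the lemma of du Bois-Reymond together with the
  divergence of the integral of 1/r at 0, which excludes a nonzero constant of integration.\<close>

lemma eq_if_all_le_mult:
  fixes x y M :: real
  assumes "\<And>e. e > 0 \<Longrightarrow> \<bar>x - y\<bar> \<le> e * M"
  shows "x = y"
proof (rule ccontr)
  assume "x \<noteq> y"
  define e where "e = \<bar>x - y\<bar> / (\<bar>M\<bar> + 1)"
  have "e > 0"
    using \<open>x \<noteq> y\<close> by (simp add: e_def)
  have "e * \<bar>M\<bar> + e \<le> e * M"
  proof -
    have "e * (\<bar>M\<bar> + 1) = \<bar>x - y\<bar>"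
      unfolding e_def by (rule nonzero_eq_divide_eq[THEN iffD1]) auto
    then show ?thesis
      using assms[OF \<open>e > 0\<close>] by (simp only: distrib_left mult_1_right)
  qed
  moreover have "e * M \<le> e * \<bar>M\<bar>"
    using \<open>e > 0\<close> by (intro mult_left_mono) auto
  ultimately show False
    using \<open>e > 0\<close> by linarith
qed

text \<open>The difference \<open>h\<close> of the two sides satisfies \<open>\<bar>h t - h s\<bar> \<le> e \<integral> norm f'\<close> on all short intervals
  \<open>[s, t]\<close>. This estimate is additive, so bisection extends it to \<open>[a, b]\<close>; almost everywhere
  differentiability of \<open>f\<close> is not used.\<close>

lemma absolutely_continuous_chain_rule:
  fixes F :: "'a::euclidean_space \<Rightarrow> real" and f f' :: "real \<Rightarrow> 'a"
  assumes f': "f' absolutely_integrable_on {a..b}"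
    and f: "\<And>x. x \<in> {a..b} \<Longrightarrow> f x = f a + integral {a..x} f'"
    and F: "\<And>z. (F has_derivative (\<lambda>h. G z \<bullet> h)) (at z)"
    and G: "continuous_on UNIV G"
    and ab: "a \<le> b"
  shows "(\<lambda>x. G (f x) \<bullet> f' x) absolutely_integrable_on {a..b}" (is ?A)
    and "F (f b) = F (f a) + integral {a..b} (\<lambda>x. G (f x) \<bullet> f' x)" (is ?B)
proof -
  have sub: "f' absolutely_integrable_on {s..t}" "f' integrable_on {s..t}" if "a \<le> s" "t \<le> b" for s t
    using set_integrable_subset[OF f', of "{s..t}"] that
    by (auto simp: set_lebesgue_integral_eq_integral)
  have int: "f' integrable_on {a..b}"
    using f' by (auto simp: set_lebesgue_integral_eq_integral)
  have "continuous_on {a..b} (\<lambda>x. f a + integral {a..x} f')"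
    by (intro continuous_intros indefinite_integral_continuous_1 int)
  then have cf: "continuous_on {a..b} f"
    by (rule continuous_on_eq) (rule f[symmetric])
  have cGf: "continuous_on {a..b} (\<lambda>x. G (f x))"
    using continuous_on_compose2[OF G cf] by auto
  have bil: "bilinear (\<lambda>x y::'a. x \<bullet> y)"
    by (simp add: bilinear_conv_bounded_bilinear bounded_bilinear_inner)
  show A: ?A
  proof (rule absolutely_integrable_bounded_measurable_product[OF bil _ _ _ f'])
    show "(\<lambda>x. G (f x)) \<in> borel_measurable (lebesgue_on {a..b})"
      by (rule continuous_imp_measurable_on_sets_lebesgue[OF cGf]) auto
    show "bounded ((\<lambda>x. G (f x)) ` {a..b})"
      by (rule compact_imp_bounded, rule compact_continuous_image[OF cGf]) simp
  qed auto
  have subA: "(\<lambda>x. G (f x) \<bullet> f' x) absolutely_integrable_on {s..t}"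
      "(\<lambda>x. G (f x) \<bullet> f' x) integrable_on {s..t}" if "a \<le> s" "t \<le> b" for s t
    using set_integrable_subset[OF A, of "{s..t}"] that
    by (auto simp: set_lebesgue_integral_eq_integral)
  define h where "h x = F (f x) - integral {a..x} (\<lambda>x. G (f x) \<bullet> f' x)" for x
  have key: "\<bar>h b - h a\<bar> \<le> e * integral {a..b} (\<lambda>x. norm (f' x))" if "e > 0" for e
  proof -
    define P where "P s t \<longleftrightarrow> (a \<le> s \<and> s \<le> t \<and> t \<le> b \<longrightarrow>
       \<bar>h t - h s\<bar> \<le> e * integral {s..t} (\<lambda>x. norm (f' x)))" for s t
    have "P a b"
    proof (rule Bolzano[OF ab])
      fix r s t assume P: "P r s" "P s t" and le: "r \<le> s" "s \<le> t"
      show "P r t"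
        unfolding P_def
      proof safe
        assume rt: "a \<le> r" "t \<le> b"
        have "(\<lambda>x. norm (f' x)) integrable_on {r..t}"
          using sub[of r t] rt by (simp add: absolutely_integrable_on_def)
        from Henstock_Kurzweil_Integration.integral_combine[OF le this]
        have "e * integral {r..t} (\<lambda>x. norm (f' x)) =
            e * integral {r..s} (\<lambda>x. norm (f' x)) + e * integral {s..t} (\<lambda>x. norm (f' x))"
          by (metis distrib_left)
        then show "\<bar>h t - h r\<bar> \<le> e * integral {r..t} (\<lambda>x. norm (f' x))"
          using P rt le unfolding P_def by linarith
      qed
    next
      fix x assume x: "a \<le> x" "x \<le> b"
      \<comment> \<open>Continuity of \<open>G\<close> at \<open>f x\<close> is spent twice with
        tolerance \<open>e / 2\<close>: once on the linearisation error of \<open>F\<close>, once on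
        the error of the integrand.\<close>
      have "isCont G (f x)"
        using G by (simp add: continuous_on_eq_continuous_at)
      then obtain d where d: "d > 0" "\<And>z. dist z (f x) < d \<Longrightarrow> dist (G z) (G (f x)) < e / 2"
        using continuous_at_eps_delta[of "f x" G] half_gt_zero[OF \<open>e > 0\<close>] by blast
      obtain d' where d': "d' > 0" "\<And>y. y \<in> {a..b} \<Longrightarrow> dist y x < d' \<Longrightarrow> dist (f y) (f x) < d"
        using cf[unfolded continuous_on_iff, rule_format, of x d] x d(1) by auto
      have "P s t" if st: "s \<le> x" "x \<le> t" "t - s < d'" for s t
        unfolding P_def
      proof safe
        assume st': "a \<le> s" "s \<le> t" "t \<le> b"
        have near: "dist (f y) (f x) < d" if "y \<in> {s..t}" for y
          using that st st' by (intro d') (auto simp: dist_real_def)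
        have comb: "integral {a..t} k = integral {a..s} k + integral {s..t} k" 
          if "k integrable_on {a..t}" for k :: "real \<Rightarrow> 'b::euclidean_space"
          using Henstock_Kurzweil_Integration.integral_combine[of a s t k] that st' by simp
        have ft: "f t - f s = integral {s..t} f'"
          using f[of s] f[of t] comb[of f'] sub[of a t] st' by simp
        have nint: "(\<lambda>x. norm (f' x)) integrable_on {s..t}"
          using sub[of s t] st' by (simp add: absolutely_integrable_on_def)
        have nf: "norm (f t - f s) \<le> integral {s..t} (\<lambda>x. norm (f' x))"
          unfolding ft using sub[of s t] st' nint
          by (intro integral_norm_bound_integral) auto
        have onle: "onorm (\<lambda>h. G z \<bullet> h - G (f x) \<bullet> h) \<le> e / 2" if "z \<in> ball (f x) d" for z
        proof (rule onorm_le)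
          fix h
          have "norm (G z \<bullet> h - G (f x) \<bullet> h) \<le> norm (G z - G (f x)) * norm h"
            by (simp add: Cauchy_Schwarz_ineq2 flip: inner_diff_left)
          also have "\<dots> \<le> e / 2 * norm h"
            using d(2)[of z] that by (intro mult_right_mono) (auto simp: dist_norm norm_minus_commute)
          finally show "norm (G z \<bullet> h - G (f x) \<bullet> h) \<le> e / 2 * norm h" .
        qed
        \<comment> \<open>Mean value inequality on a ball: by convexity the segment from
          \<open>f s\<close> to \<open>f t\<close> stays where \<open>G\<close> differs from
          \<open>G (f x)\<close> by at most \<open>e / 2\<close>.\<close>
        have "norm (F (f t) - F (f s) - G (f x) \<bullet> (f t - f s)) \<le> norm (f t - f s) * (e / 2)"
        proof (rule differentiable_bound_linearization[where S="ball (f x) d" and f'="\<lambda>z h. G z \<bullet> h"])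
          fix u :: real assume "u \<in> {0..1}"
          then have "(1 - u) *\<^sub>R f s + u *\<^sub>R f t \<in> ball (f x) d"
            using near[of s] near[of t] st'
            by (intro convexD[OF convex_ball]) (auto simp: dist_commute)
          then show "f s + u *\<^sub>R (f t - f s) \<in> ball (f x) d"
            by (simp add: algebra_simps)
        next
          fix z assume z: "z \<in> ball (f x) d"
          show "(F has_derivative (\<bullet>) (G z)) (at z within ball (f x) d)"
            using F has_derivative_at_withinI by blast
          show "onorm ((\<bullet>) (G z) - (\<bullet>) (G (f x))) \<le> e / 2"
            using onle[OF z] by (simp add: fun_diff_def)
        qed (use d in auto)
        also have "\<dots> \<le> e / 2 * integral {s..t} (\<lambda>x. norm (f' x))"
          unfolding mult.commute[of _ "e / 2"] using nf \<open>e > 0\<close> by (intro mult_left_mono) auto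
        finally have 1: "\<bar>F (f t) - F (f s) - G (f x) \<bullet> (f t - f s)\<bar> \<le> e / 2 * integral {s..t} (\<lambda>x. norm (f' x))"
          by (simp only: real_norm_def)
        have inn: "(\<lambda>y. G (f x) \<bullet> f' y) integrable_on {s..t}" 
            "integral {s..t} (\<lambda>y. G (f x) \<bullet> f' y) = G (f x) \<bullet> (f t - f s)"
          using integrable_linear[OF sub(2) bounded_linear_inner_right[of "G (f x)"], of s t] 
            integral_linear[OF sub(2) bounded_linear_inner_right[of "G (f x)"], of s t] st'
          by (auto simp: o_def ft)
        have "norm (integral {s..t} (\<lambda>y. G (f y) \<bullet> f' y - G (f x) \<bullet> f' y)) \<le>
                integral {s..t} (\<lambda>y. e / 2 * norm (f' y))"
        proof (rule integral_norm_bound_integral)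
          fix y assume y: "y \<in> {s..t}"
          have "norm (G (f y) \<bullet> f' y - G (f x) \<bullet> f' y) \<le> norm (G (f y) - G (f x)) * norm (f' y)"
            by (simp add: Cauchy_Schwarz_ineq2 flip: inner_diff_left)
          also have "\<dots> \<le> e / 2 * norm (f' y)"
            using d(2)[OF near[OF y]] by (intro mult_right_mono) (auto simp: dist_norm)
          finally show "norm (G (f y) \<bullet> f' y - G (f x) \<bullet> f' y) \<le> e / 2 * norm (f' y)" .
        next
          show "(\<lambda>y. G (f y) \<bullet> f' y - G (f x) \<bullet> f' y) integrable_on {s..t}"
            using subA[of s t] inn st' by (intro integrable_diff) auto
          show "(\<lambda>y. e / 2 * norm (f' y)) integrable_on {s..t}"
            by (rule integrable_on_mult_right[OF nint])
        qed
        then have 2: "\<bar>integral {s..t} (\<lambda>y. G (f y) \<bullet> f' y) - G (f x) \<bullet> (f t - f s)\<bar> \<le>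
              e / 2 * integral {s..t} (\<lambda>x. norm (f' x))"
          using subA[of s t] inn st' by (simp add: integral_diff)
        have "h t - h s = (F (f t) - F (f s)) - integral {s..t} (\<lambda>y. G (f y) \<bullet> f' y)"
          unfolding h_def using comb[of "\<lambda>x. G (f x) \<bullet> f' x"] subA[of a t] st' by simp
        then have "\<bar>h t - h s\<bar> \<le> e / 2 * integral {s..t} (\<lambda>x. norm (f' x)) + e / 2 * integral {s..t} (\<lambda>x. norm (f' x))"
          using 1 2 by linarith
        then show "\<bar>h t - h s\<bar> \<le> e * integral {s..t} (\<lambda>x. norm (f' x))"
          by (simp add: field_simps)
      qed
      then show "\<exists>d>0. \<forall>s t. s \<le> x \<and> x \<le> t \<and> t - s < d \<longrightarrow> P s t"
        using d'(1) by blast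
    qed
    then have "a \<le> a \<and> a \<le> b \<and> b \<le> b \<longrightarrow> \<bar>h b - h a\<bar> \<le> e * integral {a..b} (\<lambda>x. norm (f' x))"
      unfolding P_def .
    then show ?thesis
      using ab by (simp only: order_refl simp_thms)
  qed
  have "h b = h a"
    by (rule eq_if_all_le_mult) (rule key)
  then show ?B
    by (simp add: h_def)
qed

section \<open>Smooth bump functions\<close>

definition smooth :: "(real \<Rightarrow> real) \<Rightarrow> bool" where
  "smooth f \<longleftrightarrow> (\<forall>n x. (deriv ^^ n) f differentiable (at x))"

text \<open>A class of differentiable functions closed under \<open>deriv\<close> contains all
  iterated derivatives of its members, so no formula for the n-th derivative is ever
  required.\<close>

lemma smooth_coinduct:
  assumes "f \<in> S" and "\<And>f x. f \<in> S \<Longrightarrow> f differentiable (at x)" and "\<And>f. f \<in> S \<Longrightarrow> deriv f \<in> S"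
  shows "smooth f"
proof -
  have "(deriv ^^ n) f \<in> S" for n
    by (induction n) (use assms in auto)
  then show ?thesis
    using assms(2) by (auto simp: smooth_def)
qed

lemma smooth_differentiable: "smooth f \<Longrightarrow> f differentiable (at x)"
  by (metis smooth_def funpow_0)

lemma smooth_deriv: "smooth f \<Longrightarrow> smooth (deriv f)"
  unfolding smooth_def by (metis comp_apply funpow_Suc_right)

lemma smooth_has_real_derivative: "smooth f \<Longrightarrow> (f has_real_derivative deriv f x) (at x)"
  using smooth_differentiable DERIV_deriv_iff_real_differentiable by blast

lemma smooth_continuous_on: "smooth f \<Longrightarrow> continuous_on S f"
  by (meson differentiable_imp_continuous_within continuous_at_imp_continuous_on smooth_differentiable)

lemma smooth_linear_combination:
  assumes "smooth f" "smooth g"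
  shows "smooth (\<lambda>x. c * f x + d * g x)"
proof (rule smooth_coinduct)
  let ?S = "{\<lambda>x. c * f x + d * g x |f g. smooth f \<and> smooth g}"
  show "(\<lambda>x. c * f x + d * g x) \<in> ?S"
    using assms by blast
  fix h assume "h \<in> ?S"
  then obtain f g where h: "h = (\<lambda>x. c * f x + d * g x)" and fg: "smooth f" "smooth g"
    by blast
  have D: "(h has_real_derivative c * deriv f x + d * deriv g x) (at x)" for x
    unfolding h by (intro DERIV_add DERIV_cmult smooth_has_real_derivative fg)
  show "h differentiable (at x)" for x
    using D real_differentiable_def by blast
  have "deriv h = (\<lambda>x. c * deriv f x + d * deriv g x)"
    using D DERIV_imp_deriv by blast
  then show "deriv h \<in> ?S"
    using fg smooth_deriv by blast
qed

text \<open>For \<open>m = 0\<close> this is the classical flat function. The extra powers of 1/y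
  are those that differentiation produces, and \<open>s\<close> is kept free so that it can later
  tend to 0.\<close>

definition flat_exp :: "real \<Rightarrow> nat \<Rightarrow> real \<Rightarrow> real" where
  "flat_exp s m y = (if y > 0 then exp (- s / y) / y ^ m else 0)"

text \<open>A single term of the exponential series, the one of order \<open>m + k\<close>, already
  beats the pole of order \<open>m\<close> and leaves a factor \<open>y ^ k\<close>.\<close>

lemma flat_exp_le:
  assumes "s > 0" "y \<ge> 0"
  shows "flat_exp s m y \<le> fact (m + k) / s ^ (m + k) * y ^ k"
proof (cases "y > 0")
  case True
  let ?n = "m + k"
  define t where "t = s / y"
  have "t > 0"
    using True assms by (simp add: t_def)
  have "sum (\<lambda>n. t ^ n /\<^sub>R fact n) {?n} \<le> (\<Sum>n. t ^ n /\<^sub>R fact n)"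
    using \<open>t > 0\<close> by (intro sum_le_suminf summable_exp_generic) auto
  then have "t ^ ?n / fact ?n \<le> exp t"
    by (simp add: exp_def divide_inverse_commute)
  then have "exp (- t) \<le> fact ?n / t ^ ?n"
    using \<open>t > 0\<close> by (simp add: exp_minus field_simps)
  then have "exp (- t) / y ^ m \<le> fact ?n / t ^ ?n / y ^ m"
    using True by (intro divide_right_mono) auto
  also have "\<dots> = fact ?n / s ^ ?n * y ^ k"
    using True \<open>s > 0\<close> by (simp add: t_def power_divide power_add)
  finally show ?thesis
    using True by (simp add: flat_exp_def t_def)
qed (use assms in \<open>simp add: flat_exp_def\<close>)

lemma flat_exp_DERIV:
  assumes "s > 0"
  shows "(flat_exp s m has_real_derivative s * flat_exp s (m + 2) y - m * flat_exp s (m + 1) y) (at y)"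
proof -
  consider "y > 0" | "y < 0" | "y = 0" by linarith
  then show ?thesis
  proof cases
    case 1
    have "((\<lambda>y. exp (- s / y) / y ^ m) has_real_derivative s * flat_exp s (m + 2) y - m * flat_exp s (m + 1) y) (at y)"
      unfolding flat_exp_def using 1
      by (auto intro!: derivative_eq_intros simp: field_simps power2_eq_square simp flip: power_Suc) (cases m; simp add: field_simps)
    then show ?thesis
      by (rule has_field_derivative_transform_within_open[where S="{0<..}"]) (use 1 in \<open>auto simp: flat_exp_def\<close>)
  next
    case 2
    have "((\<lambda>y. 0) has_real_derivative s * flat_exp s (m + 2) y - m * flat_exp s (m + 1) y) (at y)"
      using 2 by (simp add: flat_exp_def)
    then show ?thesis
      by (rule has_field_derivative_transform_within_open[where S="{..<0}"]) (use 2 in \<open>auto simp: flat_exp_def\<close>)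
  next
    case 3
    define C where "C = fact (m + 2) / s ^ (m + 2)"
    have "C \<ge> 0"
      using assms by (simp add: C_def)
    \<comment> \<open>At the junction the difference quotient is O(|h|): this is
      \<open>flat_exp_le\<close> with \<open>k = 2\<close>, one power being lost to the division by
      h.\<close>
    have bound: "norm (flat_exp s m h / h) \<le> C * \<bar>h\<bar>" for h
    proof (cases "h > 0")
      case True
      then show ?thesis
        using flat_exp_le[OF assms, of h m 2] 
        by (simp add: C_def flat_exp_def field_simps power2_eq_square)
    next
      case False
      then have "flat_exp s m h = 0"
        by (simp add: flat_exp_def)
      then show ?thesis
        using mult_nonneg_nonneg[OF \<open>C \<ge> 0\<close> abs_ge_zero[of h]] by simp
    qed
    have "((\<lambda>h. C * \<bar>h\<bar>) \<longlongrightarrow> C * \<bar>0\<bar>) (at (0::real))"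
      by (intro tendsto_intros)
    then have "((\<lambda>h. C * \<bar>h\<bar>) \<longlongrightarrow> 0) (at (0::real))"
      by simp
    then have "((\<lambda>h. flat_exp s m h / h) \<longlongrightarrow> 0) (at 0)"
      by (rule Lim_null_comparison[rotated]) (use bound in simp)
    then show ?thesis
      using 3 by (simp add: DERIV_def flat_exp_def)
  qed
qed

lemma flat_exp_shift: "flat_exp s m y = y\<^sup>2 * flat_exp s (m + 2) y" "flat_exp s (m + 1) y = y * flat_exp s (m + 2) y"
  by (auto simp: flat_exp_def power_add power2_eq_square)

text \<open>Polynomial multiples of \<open>flat_exp s m\<close> composed with q, over all
  \<open>m\<close>, form a class closed under differentiation.\<close>

lemma smooth_flat_exp_poly:
  assumes "s > 0"
  shows "smooth (\<lambda>x. flat_exp s 0 (poly q x))"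
proof (rule smooth_coinduct)
  let ?S = "{\<lambda>x. poly P x * flat_exp s m (poly q x) |P m. True}"
  show "(\<lambda>x. flat_exp s 0 (poly q x)) \<in> ?S"
    by (rule CollectI, rule exI[of _ 1]) auto
  fix h assume "h \<in> ?S"
  then obtain P m where h: "h = (\<lambda>x. poly P x * flat_exp s m (poly q x))"
    by blast
  \<comment> \<open>By \<open>flat_exp_shift\<close> all terms of the derivative are brought to the
    exponent \<open>m + 2\<close>; this costs the factors \<open>q\<^sup>2\<close> and
    \<open>q\<close>.\<close>
  define R where "R = pderiv P * q\<^sup>2 + P * pderiv q * ([:s:] - of_nat m * q)"
  have D: "(h has_real_derivative poly R x * flat_exp s (m + 2) (poly q x)) (at x)" for x
    unfolding h
    apply (rule derivative_eq_intros poly_DERIV DERIV_chain2[OF flat_exp_DERIV[OF assms]] refl)+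
    using flat_exp_shift(1)[of s m "poly q x"] flat_exp_shift(2)[of s m "poly q x"]
    by (simp add: R_def algebra_simps)
  show "h differentiable (at x)" for x
    using D real_differentiable_def by blast
  have "deriv h = (\<lambda>x. poly R x * flat_exp s (m + 2) (poly q x))"
    using D DERIV_imp_deriv by blast
  then show "deriv h \<in> ?S"
    by blast
qed

text \<open>For a < b the quadratic is positive exactly between a and b, so the support does not
  depend on \<open>n\<close>. As the parameter 1 / Suc n tends to 0, the values on the open interval
  tend to 1.\<close>

definition bump :: "real \<Rightarrow> real \<Rightarrow> nat \<Rightarrow> real \<Rightarrow> real" where
  "bump a b n x = flat_exp (1 / Suc n) 0 ((x - a) * (b - x))"

lemma smooth_bump: "smooth (bump a b n)"
proof -
  have "(\<lambda>x. flat_exp (1 / Suc n) 0 (poly [:- (a * b), a + b, -1:] x)) = bump a b n"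
    by (auto simp: bump_def algebra_simps)
  then show ?thesis
    using smooth_flat_exp_poly[of "1 / Suc n" "[:- (a * b), a + b, -1:]"] by simp
qed

lemma bump_bounds: "0 \<le> bump a b n x" "bump a b n x \<le> 1"
  by (auto simp: bump_def flat_exp_def)

lemma bump_outside: "a \<le> b \<Longrightarrow> x \<notin> {a<..<b} \<Longrightarrow> bump a b n x = 0"
  by (auto simp: bump_def flat_exp_def zero_less_mult_iff)

lemma bump_tendsto: "a \<le> b \<Longrightarrow> (\<lambda>n. bump a b n x) \<longlonglongrightarrow> indicator {a<..<b} x"
proof (cases "x \<in> {a<..<b}")
  case True
  define q where "q = (x - a) * (b - x)"
  have "q > 0"
    using True by (simp add: q_def)
  have "(\<lambda>n. 1 / real (Suc n)) \<longlonglongrightarrow> 0"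
    using lim_1_over_n[THEN LIMSEQ_Suc] .
  then have "(\<lambda>n. exp (- (1 / real (Suc n)) / q)) \<longlonglongrightarrow> exp (- 0 / q)"
    by (intro tendsto_intros) (use \<open>q > 0\<close> in auto)
  then show ?thesis
    using True \<open>q > 0\<close> by (simp add: bump_def flat_exp_def flip: q_def)
qed (simp add: bump_outside)

section \<open>The lemmas of Lagrange and du Bois-Reymond\<close>

lemma test_fun_iff_smooth:
  "test_fun S \<phi> \<longleftrightarrow> smooth \<phi> \<and> (\<exists>K. compact K \<and> K \<subseteq> S \<and> (\<forall>x. x \<notin> K \<longrightarrow> \<phi> x = 0))"
  by (simp add: test_fun_def smooth_def)

lemma test_fun_bump:
  assumes "a \<le> b" "{a..b} \<subseteq> S"
  shows "test_fun S (bump a b n)"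
  unfolding test_fun_iff_smooth
  using assms by (intro conjI smooth_bump exI[of _ "{a..b}"]) (auto intro!: bump_outside)

text \<open>Since the bumps lie between 0 and 1 and vanish off the interval, |u| on the interval is
  a dominating function; the missing endpoints form a null set.\<close>

lemma bump_integral_tendsto:
  assumes u: "u absolutely_integrable_on {a..b}" and "a \<le> b" "{a..b} \<subseteq> S"
  shows "(\<lambda>n. LINT x:S|lebesgue. u x * bump a b n x) \<longlonglongrightarrow> integral {a..b} u"
proof -
  let ?w = "\<lambda>x. indicator {a..b} x *\<^sub>R u x"
  have w: "integrable lebesgue ?w"
    using u by (simp add: set_integrable_def)
  have [measurable]: "bump a b n \<in> borel_measurable lebesgue" for n
    using smooth_continuous_on[OF smooth_bump, of UNIV a b n]
    by (intro measurable_completion) (simp add: borel_measurable_continuous_onI)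
  have "(\<lambda>n. LINT x|lebesgue. ?w x * bump a b n x) \<longlonglongrightarrow> (LINT x|lebesgue. ?w x * indicator {a<..<b} x)"
  proof (rule integral_dominated_convergence[where w="\<lambda>x. norm (?w x)"])
    show "AE x in lebesgue. (\<lambda>n. ?w x * bump a b n x) \<longlonglongrightarrow> ?w x * indicator {a<..<b} x"
      by (intro AE_I2 tendsto_intros bump_tendsto \<open>a \<le> b\<close>)
    show "AE x in lebesgue. norm (?w x * bump a b n x) \<le> norm (?w x)" for n
      using bump_bounds[of a b n] by (intro AE_I2) (simp only: norm_mult, intro mult_right_le_one_le; simp)
    show "integrable lebesgue (\<lambda>x. norm (?w x))"
      using w by (rule integrable_norm)
    show "(\<lambda>x. ?w x * indicator {a<..<b} x) \<in> borel_measurable lebesgue"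
      using w by (intro borel_measurable_times borel_measurable_indicator) auto
    show "(\<lambda>x. ?w x * bump a b n x) \<in> borel_measurable lebesgue" for n
      using w by (intro borel_measurable_times) auto
  qed
  moreover have "(LINT x:S|lebesgue. u x * bump a b n x) = (LINT x|lebesgue. ?w x * bump a b n x)" for n
    unfolding set_lebesgue_integral_def
    by (rule Bochner_Integration.integral_cong)
       (use \<open>{a..b} \<subseteq> S\<close> bump_outside[OF \<open>a \<le> b\<close>] in \<open>force simp: indicator_def\<close>)+
  moreover have "(LINT x|lebesgue. ?w x * indicator {a<..<b} x) = (LINT x:{a<..<b}|lebesgue. u x)"
    unfolding set_lebesgue_integral_def
    by (rule Bochner_Integration.integral_cong) (auto simp: indicator_def)
  moreover have "u absolutely_integrable_on {a<..<b}"
    by (rule set_integrable_subset[OF u]) auto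
  ultimately show ?thesis
    by (simp add: set_lebesgue_integral_eq_integral integral_open_interval_real)
qed

text \<open>Half-open intervals are stable under intersection and generate the Borel sets, so the
  signed measure with density u vanishes on every Borel set, and its density is zero almost
  everywhere.\<close>

lemma AE_zero_if_integrals_zero:
  fixes u :: "real \<Rightarrow> real"
  assumes u: "u absolutely_integrable_on {a..b}"
    and zero: "\<And>c d. a \<le> c \<Longrightarrow> c < d \<Longrightarrow> d \<le> b \<Longrightarrow> integral {c..d} u = 0"
  shows "AE x in lebesgue. x \<in> {a..b} \<longrightarrow> u x = 0"
proof -
  let ?w = "\<lambda>x. indicator {a..b} x *\<^sub>R u x"
  have w: "integrable lebesgue ?w"
    using u by (simp add: set_integrable_def)
  \<comment> \<open>The induction over the generated sigma-algebra only reaches Borel sets, hence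
    the passage to a Borel representative.\<close>
  then obtain v where v[measurable]: "v \<in> borel_measurable lborel" and wv: "AE x in lborel. ?w x = v x"
    using completion_ex_borel_measurable_real[of ?w lborel] by auto
  have wv': "AE x in lebesgue. ?w x = v x"
    using wv by (rule AE_completion)
  have vL: "v \<in> borel_measurable lebesgue"
    using v by (rule measurable_completion)
  have "integrable lebesgue v"
    using integrable_cong_AE[OF _ vL wv'] w by auto
  then have vint: "integrable lborel v"
    by (simp add: integrable_completion v)
  have Ioc: "(LINT x:{c<..d}|lborel. v x) = 0" for c d
  proof -
    have "(LINT x:{c<..d}|lborel. v x) = (LINT x:{c<..d}|lebesgue. v x)"
      unfolding set_lebesgue_integral_def by (rule integral_completion[symmetric]) measurable
    also have "\<dots> = (LINT x|lebesgue. indicator {c<..d} x *\<^sub>R ?w x)"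
      unfolding set_lebesgue_integral_def
    proof (rule integral_cong_AE)
      show "(\<lambda>x. indicator {c<..d} x *\<^sub>R v x) \<in> borel_measurable lebesgue"
        by (intro borel_measurable_scaleR vL borel_measurable_indicator) auto
      show "(\<lambda>x. indicator {c<..d} x *\<^sub>R ?w x) \<in> borel_measurable lebesgue"
        by (intro borel_measurable_scaleR borel_measurable_indicator borel_measurable_integrable[OF w]) auto
      show "AE x in lebesgue. indicator {c<..d} x *\<^sub>R v x = indicator {c<..d} x *\<^sub>R ?w x"
        using wv' by eventually_elim simp
    qed
    \<comment> \<open>The half-open interval meets the closed one in a closed interval that lacks
      its left endpoint exactly when this endpoint is c; the removed point is a null set.\<close>
    also have "\<dots> = (LINT x:{max a c..min b d} - (if max a c = c then {c} else {})|lebesgue. u x)"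
      unfolding set_lebesgue_integral_def
      by (rule Bochner_Integration.integral_cong) (auto simp: indicator_def max_def)
    also have "\<dots> = integral ({max a c..min b d} - (if max a c = c then {c} else {})) u"
      by (intro set_lebesgue_integral_eq_integral set_integrable_subset[OF u]) auto
    also have "\<dots> = integral {max a c..min b d} u"
      by (rule integral_subset_negligible) (auto intro: negligible_subset[OF negligible_sing[of c]])
    also have "\<dots> = 0"
    proof (cases "max a c < min b d")
      case True
      then show ?thesis by (intro zero) auto
    next
      case False
      then have "{max a c..min b d} \<subseteq> {max a c}" by auto
      then have "negligible {max a c..min b d}"
        using negligible_subset negligible_sing by blast
      then show ?thesis by (rule integral_negligible)
    qed
    finally show ?thesis .
  qed
  \<comment> \<open>The total integral is what makes the complement step of the induction
    work.\<close>
  have whole: "(LINT x|lborel. v x) = 0"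
  proof -
    have "(LINT x|lborel. v x) = (LINT x|lebesgue. v x)"
      by (rule integral_completion[symmetric]) measurable
    also have "\<dots> = (LINT x|lebesgue. ?w x)"
      by (rule integral_cong_AE) (use vL w wv' in auto)
    also have "\<dots> = integral {a..b} u"
      using set_lebesgue_integral_eq_integral(2)[OF u] by (simp add: set_lebesgue_integral_def)
    also have "\<dots> = 0"
    proof (cases "a < b")
      case False
      then have "{a..b} \<subseteq> {a}" by auto
      then have "negligible {a..b}"
        using negligible_subset negligible_sing by blast
      then show ?thesis by (rule integral_negligible)
    qed (simp add: zero)
    finally show ?thesis .
  qed
  have sint: "set_integrable lborel A v" if "A \<in> sets borel" for A
    unfolding set_integrable_def using that by (intro integrable_mult_indicator vint) simp
  have "AE x in lborel. v x = 0"
  proof (rule sigma_finite_measure.density_zero[OF sigma_finite_lborel vint])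
    fix A :: "real set" assume "A \<in> sets lborel"
    then have gen: "A \<in> sigma_sets UNIV (range (\<lambda>(a, b). {a <.. b::real}))"
      by (simp add: borel_sigma_sets_Ioc)
    have "Int_stable (range (\<lambda>(a, b). {a <.. b::real}))"
      by (auto simp: Int_stable_def)
    then show "(LINT x:A|lborel. v x) = 0"
    proof (rule sigma_sets_induct_disjoint[OF _ _ gen])
      fix A assume "A \<in> sigma_sets UNIV (range (\<lambda>(a, b). {a <.. b::real}))"
        and IH: "(LINT x:A|lborel. v x) = 0"
      then have A: "A \<in> sets borel"
        by (simp add: borel_sigma_sets_Ioc)
      have "(LINT x:A \<union> (UNIV - A)|lborel. v x) = (LINT x:A|lborel. v x) + (LINT x:UNIV - A|lborel. v x)"
        by (rule set_integral_Un) (use A sint in auto)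
      then show "(LINT x:UNIV - A|lborel. v x) = 0"
        using IH whole by (simp add: set_lebesgue_integral_def)
    next
      fix A :: "nat \<Rightarrow> real set"
      assume disj: "disjoint_family A" and "range A \<subseteq> sigma_sets UNIV (range (\<lambda>(a, b). {a <.. b::real}))"
        and IH: "\<And>i. (LINT x:A i|lborel. v x) = 0"
      then have A: "A i \<in> sets borel" for i
        by (auto simp: borel_sigma_sets_Ioc)
      have "(LINT x:(\<Union>i. A i)|lborel. v x) = (\<Sum>i. (LINT x:(A i)|lborel. v x))"
        by (rule lebesgue_integral_countable_add)
           (use A disj sint in \<open>auto simp: disjoint_family_on_def\<close>)
      then show "(LINT x:(\<Union>i. A i)|lborel. v x) = 0"
        using IH by simp
    next
      fix A :: "real set" assume "A \<in> range (\<lambda>(a, b). {a <.. b::real})"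
      then show "(LINT x:A|lborel. v x) = 0"
        using Ioc by auto
    qed (auto simp: set_lebesgue_integral_def)
  qed
  then have "AE x in lebesgue. v x = 0"
    by (rule AE_completion)
  with wv' show ?thesis
    by eventually_elim (auto simp: indicator_def)
qed

lemma AE_zero_if_integrals_zero_pos:
  fixes u :: "real \<Rightarrow> real"
  assumes u: "\<And>a b. 0 < a \<Longrightarrow> u absolutely_integrable_on {a..b}"
    and zero: "\<And>a b. 0 < a \<Longrightarrow> a < b \<Longrightarrow> integral {a..b} u = 0"
  shows "AE x in lebesgue. x > 0 \<longrightarrow> u x = 0"
proof -
  have "AE x in lebesgue. \<forall>n. x \<in> {1 / Suc n..real (Suc n)} \<longrightarrow> u x = 0"
    unfolding AE_all_countable
    by (intro allI AE_zero_if_integrals_zero u zero) (auto intro: order.strict_trans2[rotated])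
  then show ?thesis
  proof eventually_elim
    case (elim x)
    show ?case
    proof
      assume "x > 0"
      obtain n1 where "1 / Suc n1 < x"
        using \<open>x > 0\<close> nat_approx_posE by blast
      obtain n2 :: nat where "x \<le> n2"
        using real_arch_simple by blast
      define n where "n = max n1 n2"
      have "1 / Suc n \<le> 1 / Suc n1"
        by (intro divide_left_mono) (auto simp: n_def)
      then have "x \<in> {1 / Suc n..real (Suc n)}"
        using \<open>1 / Suc n1 < x\<close> \<open>x \<le> n2\<close> by (auto simp: n_def)
      then show "u x = 0"
        using elim by blast
    qed
  qed
qed

lemma fundamental_lemma_variations:
  assumes u: "\<And>a b. 0 < a \<Longrightarrow> u absolutely_integrable_on {a..b}"
    and zero: "\<And>\<phi>. test_fun {0<..} \<phi> \<Longrightarrow> (LINT x:{0<..}|lebesgue. u x * \<phi> x) = 0"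
  shows "AE x in lebesgue. x > 0 \<longrightarrow> u x = 0"
proof (rule AE_zero_if_integrals_zero_pos[OF u])
  fix a b :: real assume "0 < a" "a < b"
  then have "(\<lambda>n. LINT x:{0<..}|lebesgue. u x * bump a b n x) \<longlonglongrightarrow> integral {a..b} u"
    by (intro bump_integral_tendsto u) auto
  moreover have "(LINT x:{0<..}|lebesgue. u x * bump a b n x) = 0" for n
    using \<open>0 < a\<close> \<open>a < b\<close> by (intro zero test_fun_bump) auto
  ultimately show "integral {a..b} u = 0"
    by (simp add: LIMSEQ_const_iff)
qed

text \<open>Mean zero makes the primitive vanish again to the right of the support: the functions of
  mean zero are exactly the derivatives available for testing.\<close>

lemma test_fun_primitive:
  assumes k: "smooth k" and supp: "\<And>x. x \<notin> {a..b} \<Longrightarrow> k x = 0" and "0 < a" "a \<le> b"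
    and zero: "integral {a..b} k = 0"
  obtains \<Phi> where "test_fun {0<..} \<Phi>" "deriv \<Phi> = k"
proof
  define \<Phi> where "\<Phi> x = integral {0..x} k" for x
  have cont: "continuous_on S k" for S
    using k by (rule smooth_continuous_on)
  \<comment> \<open>Negative \<open>x\<close> are included: there \<open>{0..x}\<close> is empty, so
    one formula defines the primitive on the whole line.\<close>
  have small: "\<Phi> x = 0" if "x < a" for x
    unfolding \<Phi>_def using that supp by (intro integral_unique has_integral_is_0) auto
  have large: "\<Phi> x = 0" if "x \<ge> b" for x
  proof -
    have "\<Phi> x = integral {0..x} (\<lambda>y. if y \<in> {a..b} then k y else 0)"
      unfolding \<Phi>_def using supp by (intro integral_cong) auto
    also have "\<dots> = integral {a..b} k"
      using that \<open>0 < a\<close> unfolding integral_restrict_Int by (intro arg_cong2[where f=integral]) auto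
    finally have "\<Phi> x = integral {a..b} k" .
    then show ?thesis using zero by simp
  qed
  have D: "(\<Phi> has_real_derivative k x) (at x)" for x
  proof (cases "x < a")
    case True
    have "((\<lambda>x. 0) has_real_derivative k x) (at x)"
      using supp[of x] True by simp
    then show ?thesis
      by (rule has_field_derivative_transform_within_open[where S="{..<a}"]) (use True small in auto)
  next
    case False
    have "(\<Phi> has_real_derivative k x) (at x within {0..x + 1})"
      unfolding \<Phi>_def using False \<open>0 < a\<close> by (intro integral_has_real_derivative cont) auto
    moreover have "x \<in> interior {0..x + 1}"
      using False \<open>0 < a\<close> by simp
    ultimately show ?thesis
      using at_within_interior by metis
  qed
  show deriv: "deriv \<Phi> = k"
    using D DERIV_imp_deriv by blast
  have "smooth \<Phi>"
  proof (rule smooth_coinduct[where S="insert \<Phi> {f. smooth f}"])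
    fix f assume f: "f \<in> insert \<Phi> {f. smooth f}"
    then show "f differentiable (at x)" for x
      using smooth_differentiable D real_differentiable_def by blast
    show "deriv f \<in> insert \<Phi> {f. smooth f}"
      using f deriv smooth_deriv k by auto
  qed auto
  then show "test_fun {0<..} \<Phi>"
    unfolding test_fun_iff_smooth
    using small large \<open>0 < a\<close> by (intro conjI exI[of _ "{a..b}"]) auto
qed

text \<open>Two bumps, each weighted by the integral of the other, have a combination of mean zero,
  which is therefore the derivative of a test function. In the limit the mean of u over any interval
  equals its mean over a fixed one.\<close>

lemma du_Bois_Reymond:
  assumes u: "\<And>a b. 0 < a \<Longrightarrow> u absolutely_integrable_on {a..b}"
    and zero: "\<And>\<phi>. test_fun {0<..} \<phi> \<Longrightarrow> (LINT x:{0<..}|lebesgue. u x * deriv \<phi> x) = 0"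
  obtains c where "AE x in lebesgue. x > 0 \<longrightarrow> u x = c"
proof
  \<comment> \<open>The reference interval has length 1, so its integral is already the
    mean.\<close>
  define c where "c = integral {1..2} u"
  have uc: "(\<lambda>x. u x - c) absolutely_integrable_on {a..b}" if "0 < a" for a b
    using u[OF that] by (intro set_integral_diff) auto
  have "AE x in lebesgue. x > 0 \<longrightarrow> u x - c = 0"
  proof (rule AE_zero_if_integrals_zero_pos[OF uc])
    fix a b :: real assume ab: "0 < a" "a < b"
    define l where "l = min a 1"
    define r where "r = max b 2"
    have lr: "0 < l" "l \<le> r" "l \<le> a" "l \<le> 1" "b \<le> r" "2 \<le> r"
      using ab by (auto simp: l_def r_def)
    let ?J = "\<lambda>w. (LINT x:{0<..}|lebesgue. w x)"
    define A where "A n = ?J (bump a b n)" for n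
    define B where "B n = ?J (bump 1 2 n)" for n
    have bi: "bump s t n absolutely_integrable_on {l..r}" for s t n
      by (intro absolutely_integrable_continuous_real smooth_continuous_on smooth_bump)
    have supp: "?J (\<lambda>x. v x * bump s t n x) = integral {l..r} (\<lambda>x. v x * bump s t n x)" (is ?eq)
      "set_integrable lebesgue {0<..} (\<lambda>x. v x * bump s t n x)" (is ?int)
      if v: "v absolutely_integrable_on {l..r}" and st: "s \<le> t" "l \<le> s" "t \<le> r" for v s t n
    proof -
      have "(\<lambda>x. bump s t n x * v x) absolutely_integrable_on {l..r}"
        using bump_bounds[of s t n]
        by (intro absolutely_integrable_bounded_measurable_product_real v
             continuous_imp_measurable_on_sets_lebesgue smooth_continuous_on smooth_bump)
           (auto simp: bounded_iff intro!: exI[of _ 1])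
      then have vi: "(\<lambda>x. v x * bump s t n x) absolutely_integrable_on {l..r}"
        by (simp add: mult.commute)
      have eq: "indicator {0<..} x *\<^sub>R (v x * bump s t n x) = indicator {l..r} x *\<^sub>R (v x * bump s t n x)" for x
        using st lr bump_outside[OF st(1), of x n] by (auto simp: indicator_def)
      show ?int
        using vi unfolding set_integrable_def eq .
      show ?eq
        using set_lebesgue_integral_eq_integral(2)[OF vi] unfolding set_lebesgue_integral_def eq .
    qed
    have ur: "u absolutely_integrable_on {l..r}" and one: "(\<lambda>x. 1::real) absolutely_integrable_on {l..r}"
      using u lr by auto
    have eq: "B n * ?J (\<lambda>x. u x * bump a b n x) = A n * ?J (\<lambda>x. u x * bump 1 2 n x)" for n
    proof -
      let ?k = "\<lambda>x. B n * bump a b n x + (- A n) * bump 1 2 n x"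
      have ks: "smooth ?k"
        by (intro smooth_linear_combination smooth_bump)
      have "integral {l..r} ?k = B n * integral {l..r} (bump a b n) + (- A n) * integral {l..r} (bump 1 2 n)"
        using set_lebesgue_integral_eq_integral(1)[OF bi]
        by (subst integral_add) (simp_all add: integrable_on_mult_right integrable_neg del: mult_minus_left)
      also have "\<dots> = 0"
        using supp(1)[OF one, of a b n] supp(1)[OF one, of 1 2 n] ab lr by (simp add: A_def B_def)
      finally have k0: "integral {l..r} ?k = 0" .
      obtain \<Phi> where \<Phi>: "test_fun {0<..} \<Phi>" "deriv \<Phi> = ?k"
      proof (rule test_fun_primitive[OF ks _ lr(1,2) k0])
        fix x assume "x \<notin> {l..r}"
        then show "?k x = 0"
          using bump_outside[of a b x n] bump_outside[of 1 2 x n] ab lr by auto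
      qed
      have "0 = ?J (\<lambda>x. B n * (u x * bump a b n x) - A n * (u x * bump 1 2 n x))"
        using zero[OF \<Phi>(1)] by (simp add: \<Phi>(2) algebra_simps)
      also have "\<dots> = B n * ?J (\<lambda>x. u x * bump a b n x) - A n * ?J (\<lambda>x. u x * bump 1 2 n x)"
        using supp(2)[OF ur, of a b n] supp(2)[OF ur, of 1 2 n] ab lr
        by (subst set_integral_diff) auto
      finally show ?thesis by simp
    qed
    have A: "A \<longlonglongrightarrow> b - a" and B: "B \<longlonglongrightarrow> 1"
    proof -
      have *: "(\<lambda>n. ?J (bump s t n)) \<longlonglongrightarrow> t - s" if "0 < s" "s < t" for s t
        using bump_integral_tendsto[of s t "\<lambda>x. 1::real" "{0<..}"] that
        by (simp add: absolutely_integrable_continuous_real subset_eq)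
      show "A \<longlonglongrightarrow> b - a" "B \<longlonglongrightarrow> 1"
        using *[of a b] *[of 1 2] ab by (simp_all add: A_def[abs_def] B_def[abs_def])
    qed
    have "(\<lambda>n. B n * ?J (\<lambda>x. u x * bump a b n x)) \<longlonglongrightarrow> 1 * integral {a..b} u"
      using B ab by (intro tendsto_mult bump_integral_tendsto u) auto
    then have lim: "(\<lambda>n. A n * ?J (\<lambda>x. u x * bump 1 2 n x)) \<longlonglongrightarrow> integral {a..b} u"
      unfolding eq by simp
    have "(\<lambda>n. A n * ?J (\<lambda>x. u x * bump 1 2 n x)) \<longlonglongrightarrow> (b - a) * c"
      unfolding c_def using A ab by (intro tendsto_mult bump_integral_tendsto u) auto
    with lim have "integral {a..b} u = (b - a) * c"
      by (rule LIMSEQ_unique)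
    then show "integral {a..b} (\<lambda>x. u x - c) = 0"
      using set_lebesgue_integral_eq_integral(1)[OF u[OF ab(1), of b]] ab
      by (subst integral_diff) auto
  qed
  then show "AE x in lebesgue. x > 0 \<longrightarrow> u x = c"
    by simp
qed

section \<open>Absolutely continuous functions on the half-line\<close>

text \<open>Absolute continuity as a relation that carries the derivative along, since the latter is
  determined only up to null sets. Integrability of \<open>g\<close> up to 0 is part of the notion;
  it allows integration to start at the origin.\<close>

definition primitive :: "(real \<Rightarrow> real) \<Rightarrow> (real \<Rightarrow> real) \<Rightarrow> bool" where
  "primitive f g \<longleftrightarrow>
     (\<forall>b. g absolutely_integrable_on {0..b}) \<and> (\<forall>x\<ge>0. f x = f 0 + integral {0..x} g)"

lemma primitive_absolutely_integrable: "primitive f g \<Longrightarrow> g absolutely_integrable_on {0..b}"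
  by (simp add: primitive_def)

lemma primitive_integrable: "primitive f g \<Longrightarrow> g integrable_on {0..b}"
  using primitive_absolutely_integrable set_lebesgue_integral_eq_integral(1) by blast

lemma primitive_eq: "primitive f g \<Longrightarrow> x \<ge> 0 \<Longrightarrow> f x = f 0 + integral {0..x} g"
  unfolding primitive_def by blast

lemma primitive_continuous_on: 
  assumes "primitive f g"
  shows "continuous_on {0..} f"
proof -
  have c: "continuous_on {0..b} f" for b
  proof -
    have "continuous_on {0..b} (\<lambda>x. f 0 + integral {0..x} g)"
      by (intro continuous_intros indefinite_integral_continuous_1 primitive_integrable[OF assms])
    then show ?thesis
      by (rule continuous_on_eq) (use primitive_eq[OF assms, symmetric] in auto)
  qed
  show ?thesis
    unfolding continuous_on_eq_continuous_within
  proof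
    fix x :: real assume x: "x \<in> {0..}"
    have "continuous (at x within {0..x + 1}) f"
      using c[of "x + 1"] x by (auto simp: continuous_on_eq_continuous_within)
    moreover have "at x within {0..x + 1} = at x within {0..}"
      by (rule at_within_nhd[where S="{..<x + 1}"]) auto
    ultimately show "continuous (at x within {0..}) f"
      by simp
  qed
qed

lemma primitive_const: "primitive (\<lambda>x. c) (\<lambda>x. 0)"
  by (simp add: primitive_def)

lemma primitive_linear_combination:
  assumes "primitive f f'" "primitive g g'"
  shows "primitive (\<lambda>x. c * f x + d * g x) (\<lambda>x. c * f' x + d * g' x)"
  unfolding primitive_def
proof (intro conjI allI impI)
  show "(\<lambda>x. c * f' x + d * g' x) absolutely_integrable_on {0..b}" for b
    using assms by (intro set_integral_add set_integrable_mult_right primitive_absolutely_integrable)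
  fix x :: real assume x: "x \<ge> 0"
  have "integral {0..x} (\<lambda>x. c * f' x + d * g' x) = c * integral {0..x} f' + d * integral {0..x} g'"
    using assms[THEN primitive_integrable]
    by (subst integral_add) (simp_all add: integrable_on_mult_right)
  then show "c * f x + d * g x = c * f 0 + d * g 0 + integral {0..x} (\<lambda>x. c * f' x + d * g' x)"
    using primitive_eq[OF assms(1) x] primitive_eq[OF assms(2) x] by (simp add: algebra_simps)
qed

text \<open>The chain rule for the plane curve x \<mapsto> (f x, g x); the numbered facts only
  assemble its vector-valued integral from the two components.\<close>

lemma primitive_compose:
  fixes F :: "real \<times> real \<Rightarrow> real"
  assumes f: "primitive f f'" and g: "primitive g g'"
    and F: "\<And>z. (F has_derivative (\<lambda>h. G z \<bullet> h)) (at z)" "continuous_on UNIV G"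
  shows "primitive (\<lambda>x. F (f x, g x)) (\<lambda>x. G (f x, g x) \<bullet> (f' x, g' x))"
proof -
  have 1: "(\<lambda>x. (f' x, 0::real)) absolutely_integrable_on {0..b}"
    "integral {0..b} (\<lambda>x. (f' x, 0::real)) = (integral {0..b} f', 0)" for b
  proof -
    have bl: "bounded_linear (\<lambda>x::real. (x, 0::real))"
      by (intro bounded_linear_Pair bounded_linear_ident bounded_linear_zero)
    show "(\<lambda>x. (f' x, 0::real)) absolutely_integrable_on {0..b}"
      using absolutely_integrable_linear[OF primitive_absolutely_integrable[OF f] bl] by (simp add: o_def)
    show "integral {0..b} (\<lambda>x. (f' x, 0::real)) = (integral {0..b} f', 0)"
      using integral_linear[OF primitive_integrable[OF f] bl] by (simp add: o_def)
  qed
  have 2: "(\<lambda>x. (0::real, g' x)) absolutely_integrable_on {0..b}"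
    "integral {0..b} (\<lambda>x. (0::real, g' x)) = (0, integral {0..b} g')" for b
  proof -
    have bl: "bounded_linear (\<lambda>x::real. (0::real, x))"
      by (intro bounded_linear_Pair bounded_linear_ident bounded_linear_zero)
    show "(\<lambda>x. (0::real, g' x)) absolutely_integrable_on {0..b}"
      using absolutely_integrable_linear[OF primitive_absolutely_integrable[OF g] bl] by (simp add: o_def)
    show "integral {0..b} (\<lambda>x. (0::real, g' x)) = (0, integral {0..b} g')"
      using integral_linear[OF primitive_integrable[OF g] bl] by (simp add: o_def)
  qed
  have 3: "(\<lambda>x. (f' x, g' x)) absolutely_integrable_on {0..b}" for b
    using set_integral_add(1)[OF 1(1)[of b] 2(1)[of b]] by simp
  have 4: "integral {0..b} (\<lambda>x. (f' x, g' x)) = (integral {0..b} f', integral {0..b} g')" for b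
    using integral_add[OF set_lebesgue_integral_eq_integral(1)[OF 1(1)] set_lebesgue_integral_eq_integral(1)[OF 2(1)], of b]
    by (simp add: 1(2) 2(2))
  have 5: "(f x, g x) = (f 0, g 0) + integral {0..x} (\<lambda>x. (f' x, g' x))" if "x \<ge> 0" for x
    unfolding 4 using primitive_eq[OF f that] primitive_eq[OF g that] by simp
  have ai: "(\<lambda>x. G (f x, g x) \<bullet> (f' x, g' x)) absolutely_integrable_on {0..b}" if "b \<ge> 0" for b
    using absolutely_continuous_chain_rule(1)[where a=0 and b=b and f="\<lambda>x. (f x, g x)", OF 3 5 F] that by auto
  show ?thesis
    unfolding primitive_def
  proof (intro conjI allI impI)
    show "(\<lambda>x. G (f x, g x) \<bullet> (f' x, g' x)) absolutely_integrable_on {0..b}" for b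
      using ai[of b] by (cases "b \<ge> 0") auto
    fix x :: real assume "x \<ge> 0"
    then show "F (f x, g x) = F (f 0, g 0) + integral {0..x} (\<lambda>x. G (f x, g x) \<bullet> (f' x, g' x))"
      using absolutely_continuous_chain_rule(2)[where a=0 and b=x and f="\<lambda>x. (f x, g x)", OF 3 5 F] by auto
  qed
qed

lemma primitive_mult:
  assumes "primitive f f'" "primitive g g'"
  shows "primitive (\<lambda>x. f x * g x) (\<lambda>x. f' x * g x + f x * g' x)"
proof -
  have "primitive (\<lambda>x. (\<lambda>z. fst z * snd z) (f x, g x)) (\<lambda>x. (\<lambda>z. (snd z, fst z)) (f x, g x) \<bullet> (f' x, g' x))"
  proof (rule primitive_compose[OF assms])
    show "((\<lambda>z. fst z * snd z) has_derivative (\<bullet>) (snd z, fst z)) (at z)" for z :: "real \<times> real"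
      by (auto intro!: derivative_eq_intros simp: inner_prod_def algebra_simps)
    show "continuous_on UNIV (\<lambda>z::real \<times> real. (snd z, fst z))"
      by (intro continuous_intros)
  qed
  then show ?thesis
    by (simp add: mult.commute)
qed

text \<open>At the zeros of \<open>w\<close> the convention \<open>x / 0 = 0\<close> gives the correct derivative.\<close>

lemma primitive_rms:
  assumes f: "primitive f f'" and g: "primitive g g'"
  defines "w \<equiv> \<lambda>x. sqrt (((f x)\<^sup>2 + (g x)\<^sup>2) / 2)"
  shows "primitive w (\<lambda>x. (f x * f' x + g x * g' x) / (2 * w x))"
proof -
  \<comment> \<open>The square root is not differentiable at 0, so a positive number is added under
    the root. The regularised derivatives are bounded by |f'| + |g'| uniformly in \<open>n\<close>,
    and dominated convergence removes the regularisation.\<close>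
  define e :: "nat \<Rightarrow> real" where "e n = 1 / Suc n" for n
  define r where "r n z = sqrt (((fst z)\<^sup>2 + (snd z)\<^sup>2) / 2 + e n)" for n and z :: "real \<times> real"
  define W where "W n x = r n (f x, g x)" for n x
  define D where "D n x = (f x * f' x + g x * g' x) / (2 * W n x)" for n x
  have e: "e n > 0" "e \<longlonglongrightarrow> 0" for n
    using lim_1_over_n[THEN LIMSEQ_Suc] by (simp_all add: e_def[abs_def])
  have arg: "((fst z)\<^sup>2 + (snd z)\<^sup>2) / 2 + e n > 0" for z :: "real \<times> real" and n
    using e(1)[of n] by (intro add_nonneg_pos) auto
  have rpos: "r n z > 0" for n z
    using arg by (simp add: r_def)
  have W: "(\<lambda>n. W n x) \<longlonglongrightarrow> w x" for x
  proof -
    have "(\<lambda>n. sqrt (((f x)\<^sup>2 + (g x)\<^sup>2) / 2 + e n)) \<longlonglongrightarrow> sqrt (((f x)\<^sup>2 + (g x)\<^sup>2) / 2 + 0)"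
      by (intro tendsto_real_sqrt tendsto_add tendsto_const e)
    then show ?thesis
      by (simp add: W_def r_def w_def)
  qed
  have prim: "primitive (W n) (D n)" for n
  proof -
    have "primitive (\<lambda>x. r n (f x, g x)) (\<lambda>x. (\<lambda>z. (fst z / (2 * r n z), snd z / (2 * r n z))) (f x, g x) \<bullet> (f' x, g' x))"
    proof (rule primitive_compose[OF f g])
      show "(r n has_derivative (\<bullet>) (fst z / (2 * r n z), snd z / (2 * r n z))) (at z)" for z
        unfolding r_def[abs_def] using arg[of z n]
        by (auto intro!: derivative_eq_intros simp: inner_prod_def fun_eq_iff field_simps)
      show "continuous_on UNIV (\<lambda>z. (fst z / (2 * r n z), snd z / (2 * r n z)))"
        using rpos[of n] unfolding r_def[abs_def] by (intro continuous_intros) (auto simp: less_le)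
    qed
    then show ?thesis
      by (simp add: W_def[abs_def] D_def[abs_def] add_divide_distrib)
  qed
  have lim: "(\<lambda>n. D n x) \<longlonglongrightarrow> (f x * f' x + g x * g' x) / (2 * w x)" for x
  proof (cases "w x = 0")
    case True
    then have "f x = 0" "g x = 0"
      by (auto simp: w_def sum_power2_eq_zero_iff)
    then show ?thesis by (simp add: D_def)
  next
    case False
    from W[of x] show ?thesis
      unfolding D_def using False by (intro tendsto_intros) auto
  qed
  have bound: "norm (D n x) \<le> \<bar>f' x\<bar> + \<bar>g' x\<bar>" for n x
  proof -
    have "(2 * W n x)\<^sup>2 = 2 * (f x)\<^sup>2 + 2 * (g x)\<^sup>2 + 4 * e n"
      using arg[of "(f x, g x)" n] by (simp add: W_def r_def power_mult_distrib)
    then have "(f x)\<^sup>2 \<le> (2 * W n x)\<^sup>2" "(g x)\<^sup>2 \<le> (2 * W n x)\<^sup>2"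
      using e(1)[of n] zero_le_power2[of "f x"] zero_le_power2[of "g x"] by linarith+
    then have "\<bar>f x\<bar> \<le> 2 * W n x" "\<bar>g x\<bar> \<le> 2 * W n x"
      using rpos[of n "(f x, g x)"] by (auto simp: W_def intro: power2_le_imp_le)
    then have "\<bar>f x * f' x + g x * g' x\<bar> \<le> 2 * W n x * \<bar>f' x\<bar> + 2 * W n x * \<bar>g' x\<bar>"
      by (intro order_trans[OF abs_triangle_ineq] add_mono) (auto simp: abs_mult intro!: mult_right_mono)
    then show ?thesis
      using rpos[of n "(f x, g x)"] by (simp add: D_def W_def divide_le_eq algebra_simps)
  qed
  have hi: "(\<lambda>x. \<bar>f' x\<bar> + \<bar>g' x\<bar>) integrable_on {0..b}" for b
    using f g by (intro integrable_add) (auto simp: primitive_def absolutely_integrable_on_def)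
  have dc: "(\<lambda>x. (f x * f' x + g x * g' x) / (2 * w x)) integrable_on {0..b}"
      "(\<lambda>n. integral {0..b} (D n)) \<longlonglongrightarrow> integral {0..b} (\<lambda>x. (f x * f' x + g x * g' x) / (2 * w x))" for b
    using dominated_convergence[of D "{0..b}" "\<lambda>x. \<bar>f' x\<bar> + \<bar>g' x\<bar>", OF primitive_integrable[OF prim] hi bound lim]
    by auto
  show ?thesis
    unfolding primitive_def
  proof (intro conjI allI impI)
    show "(\<lambda>x. (f x * f' x + g x * g' x) / (2 * w x)) absolutely_integrable_on {0..b}" for b
    proof (rule absolutely_integrable_integrable_bound[OF _ dc(1) hi])
      show "norm ((f x * f' x + g x * g' x) / (2 * w x)) \<le> \<bar>f' x\<bar> + \<bar>g' x\<bar>" for x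
        by (rule tendsto_le[OF _ tendsto_const tendsto_norm[OF lim]]) (use bound in auto)
    qed
    fix x :: real assume x: "x \<ge> 0"
    have "(\<lambda>n. W n 0 + integral {0..x} (D n)) \<longlonglongrightarrow> w 0 + integral {0..x} (\<lambda>x. (f x * f' x + g x * g' x) / (2 * w x))"
      by (intro tendsto_add W dc)
    then have "(\<lambda>n. W n x) \<longlonglongrightarrow> w 0 + integral {0..x} (\<lambda>x. (f x * f' x + g x * g' x) / (2 * w x))"
      using primitive_eq[OF prim x] by simp
    with W show "w x = w 0 + integral {0..x} (\<lambda>x. (f x * f' x + g x * g' x) / (2 * w x))"
      using LIMSEQ_unique by blast
  qed
qed

text \<open>The root mean square of f with itself is |f|.\<close>

lemma primitive_abs:
  assumes "primitive f f'"
  shows "primitive (\<lambda>x. \<bar>f x\<bar>) (\<lambda>x. f x * f' x / \<bar>f x\<bar>)"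
  using primitive_rms[OF assms assms] by (simp flip: mult_2)

text \<open>From min f 1 = (f + 1 - |f - 1|) / 2. The derivative of |f - 1| is at most |f'| in
  modulus, so half the difference with f' is too.\<close>

lemma primitive_min_1:
  assumes "primitive f f'"
  shows "\<exists>d. primitive (\<lambda>x. min (f x) 1) d \<and> (\<forall>x. \<bar>d x\<bar> \<le> \<bar>f' x\<bar>)"
proof -
  have p1: "primitive (\<lambda>x. 1 * f x + (-1) * 1) (\<lambda>x. 1 * f' x + (-1) * 0)"
    by (intro primitive_linear_combination assms primitive_const)
  define a where "a x = (f x - 1) * f' x / \<bar>f x - 1\<bar>" for x
  have p2: "primitive (\<lambda>x. \<bar>f x - 1\<bar>) a"
    unfolding a_def using primitive_abs[OF p1] by simp
  have "primitive (\<lambda>x. 1 * ((1/2) * f x + (1/2) * 1) + (-(1/2)) * \<bar>f x - 1\<bar>) 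
     (\<lambda>x. 1 * ((1/2) * f' x + (1/2) * 0) + (-(1/2)) * a x)"
    by (intro primitive_linear_combination assms primitive_const p2)
  moreover have "(\<lambda>x. 1 * ((1/2) * f x + (1/2) * 1) + (-(1/2)) * \<bar>f x - 1\<bar>) = (\<lambda>x. min (f x) 1)"
    by (auto simp: min_def field_simps abs_if)
  ultimately have "primitive (\<lambda>x. min (f x) 1) (\<lambda>x. (f' x - a x) / 2)"
    by (simp add: diff_divide_distrib)
  moreover have "\<bar>(f' x - a x) / 2\<bar> \<le> \<bar>f' x\<bar>" for x
  proof -
    have "\<bar>a x\<bar> \<le> \<bar>f' x\<bar>"
      by (cases "f x = 1") (simp_all add: a_def abs_mult)
    then show ?thesis by (simp add: abs_if split: if_splits)
  qed
  ultimately show ?thesis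
    by blast
qed

section \<open>Energies on the half-line\<close>

abbreviation halfline :: "real measure" where
  "halfline \<equiv> lebesgue_on {0<..}"

text \<open>The derivative is a separate argument \<open>v\<close>, so that energies are functionals
  of the pairs in \<open>primitive\<close> and do not mention a chosen weak derivative.\<close>

definition gradient_term :: "real \<Rightarrow> real \<Rightarrow> real \<Rightarrow> real \<Rightarrow> real" where
  "gradient_term p u v r = (v\<^sup>2 + u\<^sup>2 / r\<^sup>2) powr (p / 2)"

definition gradient_energy :: "real \<Rightarrow> (real \<Rightarrow> real) \<Rightarrow> (real \<Rightarrow> real) \<Rightarrow> ennreal" where
  "gradient_energy p f g = (\<integral>\<^sup>+ r. ennreal (gradient_term p (f r) (g r) r * r) \<partial>halfline)"

definition energy :: "real \<Rightarrow> (real \<Rightarrow> real) \<Rightarrow> (real \<Rightarrow> real) \<Rightarrow> ennreal" where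
  "energy p f g = (\<integral>\<^sup>+ r. ennreal ((gradient_term p (f r) (g r) r + 1 / 2 * (1 - (f r)\<^sup>2)\<^sup>2) * r) \<partial>halfline)"

lemma AE_halfline_iff: "(AE x in halfline. P x) \<longleftrightarrow> (AE x in lebesgue. x > 0 \<longrightarrow> P x)"
  by (simp add: AE_restrict_space_iff)

lemma nn_integral_halfline:
  "(\<integral>\<^sup>+ r\<in>{0<..}. f r \<partial>lebesgue) = (\<integral>\<^sup>+ r. f r \<partial>halfline)"
  by (simp add: nn_integral_restrict_space)

lemma gradient_energy_weak_deriv:
  "(\<integral>\<^sup>+ r\<in>{0<..}. ennreal (grad_density p h r * r) \<partial>lebesgue) = gradient_energy p h (weak_deriv {0<..} h)"
  by (simp add: nn_integral_halfline gradient_energy_def gradient_term_def grad_density_def)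

lemma I_eq_energy: "I p h = energy p h (weak_deriv {0<..} h)"
  by (simp add: I_def nn_integral_halfline energy_def gradient_term_def grad_density_def)

lemma energy_cong_AE:
  assumes "AE x in halfline. f x = f' x" "AE x in halfline. g x = g' x"
  shows "energy p f g = energy p f' g'" "gradient_energy p f g = gradient_energy p f' g'"
  unfolding energy_def gradient_energy_def
  by (rule nn_integral_cong_AE; use assms in eventually_elim; simp)+

lemma gradient_energy_le_energy: "gradient_energy p f g \<le> energy p f g"
  unfolding energy_def gradient_energy_def
  by (intro nn_integral_mono ennreal_leI mult_right_mono) auto

lemma gradient_term_nonneg [simp]: "0 \<le> gradient_term p u v r"
  by (simp add: gradient_term_def)

lemma abs_powr_eq: "\<bar>v\<bar> powr p = (v\<^sup>2) powr (p / 2)" for v :: real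
proof (cases "v = 0")
  case False
  then have "v\<^sup>2 = \<bar>v\<bar> powr 2"
    by (simp add: powr_numeral)
  show ?thesis
    unfolding \<open>v\<^sup>2 = \<bar>v\<bar> powr 2\<close> powr_powr by simp
qed simp

lemma powr_le_gradient_term:
  assumes "p \<ge> 0"
  shows "\<bar>v\<bar> powr p \<le> gradient_term p u v r" "\<bar>u / r\<bar> powr p \<le> gradient_term p u v r"
  unfolding gradient_term_def abs_powr_eq
  by (rule powr_mono2; use assms in \<open>simp add: power_divide\<close>)+

lemma id_measurable_halfline [measurable]: "(\<lambda>r. r) \<in> borel_measurable halfline"
  by (rule measurable_restrict_space1, rule measurable_completion) simp

lemma gradient_term_measurable [measurable]:
  assumes [measurable]: "f \<in> borel_measurable halfline" "g \<in> borel_measurable halfline"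
  shows "(\<lambda>r. gradient_term p (f r) (g r) r) \<in> borel_measurable halfline"
proof -
  show ?thesis
    unfolding gradient_term_def by measurable
qed

lemma primitive_measurable:
  assumes "primitive f g"
  shows "f \<in> borel_measurable halfline" "g \<in> borel_measurable halfline"
proof -
  show "f \<in> borel_measurable halfline"
    by (rule continuous_imp_measurable_on_sets_lebesgue[OF continuous_on_subset[OF primitive_continuous_on[OF assms]]]) auto
  have "(\<lambda>x. indicator {0..} x *\<^sub>R g x) \<in> borel_measurable lebesgue"
  proof (rule borel_measurable_LIMSEQ_metric)
    fix n :: nat
    show "(\<lambda>x. indicator {0..real n} x *\<^sub>R g x) \<in> borel_measurable lebesgue"
      using primitive_absolutely_integrable[OF assms, of n] unfolding set_integrable_def
      by (rule borel_measurable_integrable)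
  next
    fix x :: real
    obtain N :: nat where "x \<le> N"
      using real_arch_simple by blast
    have "\<forall>\<^sub>F n in sequentially. indicator {0..real n} x *\<^sub>R g x = indicator {0..} x *\<^sub>R g x"
      using eventually_ge_at_top[of N] by eventually_elim (use \<open>x \<le> N\<close> in \<open>auto simp: indicator_def\<close>)
    then show "(\<lambda>n. indicator {0..real n} x *\<^sub>R g x) \<longlonglongrightarrow> indicator {0..} x *\<^sub>R g x"
      by (rule tendsto_eventually)
  qed
  then have "(\<lambda>x. indicator {0..} x *\<^sub>R g x) \<in> borel_measurable halfline"
    by (rule measurable_restrict_space1)
  then show "g \<in> borel_measurable halfline"
    by (rule measurable_cong[THEN iffD1, rotated]) simp
qed

section \<open>Local integrability from the weighted p-norm\<close>

lemma absolutely_integrable_on_Ioc_iff: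
  fixes d :: "real \<Rightarrow> real"
  shows "d absolutely_integrable_on {a<..b} \<longleftrightarrow> d absolutely_integrable_on {a..b}"
  by (rule absolutely_integrable_spike_set_eq) (auto intro: negligible_subset[OF negligible_sing[of a]])

lemma nn_integral_indicator_Ioc:
  "(\<integral>\<^sup>+ r. ennreal (norm (indicator {0<..b} r *\<^sub>R d r)) \<partial>lebesgue)
     = (\<integral>\<^sup>+ r. ennreal \<bar>d r\<bar> * indicator {..b} r \<partial>halfline)"
  unfolding nn_integral_halfline[symmetric]
  by (rule nn_integral_cong) (auto simp: indicator_def)

lemma absolutely_integrable_halflineI:
  assumes "d \<in> borel_measurable halfline" 
    and "(\<integral>\<^sup>+ r. ennreal \<bar>d r\<bar> * indicator {..b} r \<partial>halfline) < \<infinity>"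
  shows "d absolutely_integrable_on {0..b}"
proof -
  have m: "(\<lambda>r. indicator {0<..b} r *\<^sub>R d r) \<in> borel_measurable lebesgue"
  proof -
    have "(\<lambda>r. indicator {0<..} r *\<^sub>R d r) \<in> borel_measurable lebesgue"
      using assms(1) by (simp add: borel_measurable_restrict_space_iff)
    then have "(\<lambda>r. indicator {..b} r *\<^sub>R (indicator {0<..} r *\<^sub>R d r)) \<in> borel_measurable lebesgue"
      by (rule borel_measurable_scaleR[rotated]) (rule borel_measurable_indicator, simp)
    moreover have "(\<lambda>r. indicator {..b} r *\<^sub>R (indicator {0<..} r *\<^sub>R d r)) = (\<lambda>r. indicator {0<..b} r *\<^sub>R d r)"
      by (auto simp: indicator_def)
    ultimately show ?thesis by simp
  qed
  have "(\<integral>\<^sup>+ r. ennreal (norm (indicator {0<..b} r *\<^sub>R d r)) \<partial>lebesgue) < \<infinity>"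
    unfolding nn_integral_indicator_Ioc by (rule assms(2))
  with m have "d absolutely_integrable_on {0<..b}"
    unfolding set_integrable_def by (rule integrableI_bounded)
  then show ?thesis
    by (simp add: absolutely_integrable_on_Ioc_iff)
qed

text \<open>The first term is integrable at \<open>0\<close> precisely because \<open>p > 2\<close>.\<close>

lemma young_bound:
  fixes l p r d :: real
  assumes "p > 2" "l > 0" "r > 0"
  shows "\<bar>d\<bar> \<le> l * r powr (- 1 / (p - 1)) + l powr (1 - p) * (\<bar>d\<bar> powr p * r)"
proof (cases "\<bar>d\<bar> \<le> l * r powr (- 1 / (p - 1))")
  case True
  then show ?thesis
    using assms by (simp add: add_increasing2)
next
  case False
  have d: "\<bar>d\<bar> > 0"
    using False assms by (smt (verit) mult_nonneg_nonneg powr_ge_zero)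
  \<comment> \<open>Above the threshold the factor (|d| / l)^(p - 1) * r is at least 1; multiplying
    |d| by it yields the second term. The exponent of r in the threshold is the one that makes this
    factor 1 there.\<close>
  have "r powr (- 1 / (p - 1)) < \<bar>d\<bar> / l"
    using False assms by (simp add: field_simps)
  then have "(r powr (- 1 / (p - 1))) powr (p - 1) < (\<bar>d\<bar> / l) powr (p - 1)"
    using assms by (intro powr_less_mono2) auto
  moreover have "(r powr (- 1 / (p - 1))) powr (p - 1) = 1 / r"
    unfolding powr_powr using assms by (simp add: powr_minus_divide)
  ultimately have "1 / r < (\<bar>d\<bar> / l) powr (p - 1)"
    by simp
  then have "1 \<le> (\<bar>d\<bar> / l) powr (p - 1) * r"
    using assms by (simp add: field_simps)
  then have "\<bar>d\<bar> * 1 \<le> \<bar>d\<bar> * ((\<bar>d\<bar> / l) powr (p - 1) * r)"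
    by (intro mult_left_mono) auto
  also have "\<dots> = l powr (1 - p) * ((\<bar>d\<bar> powr 1 * \<bar>d\<bar> powr (p - 1)) * r)"
    using d assms by (simp add: powr_divide powr_minus_divide powr_diff field_simps)
  also have "\<bar>d\<bar> powr 1 * \<bar>d\<bar> powr (p - 1) = \<bar>d\<bar> powr p"
    unfolding powr_add[symmetric] by simp
  also have "l powr (1 - p) * (\<bar>d\<bar> powr p * r) \<le> l * r powr (- 1 / (p - 1)) + l powr (1 - p) * (\<bar>d\<bar> powr p * r)"
    using assms by simp
  finally show ?thesis by simp
qed

text \<open>The integral of \<open>r powr (- 1 / (p - 1))\<close> over (0, b), evaluated in closed
  form.\<close>

definition young_const :: "real \<Rightarrow> real \<Rightarrow> real" where
  "young_const p b = b powr (1 - 1 / (p - 1)) / (1 - 1 / (p - 1))"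

lemma young_const_nonneg: "p > 2 \<Longrightarrow> 0 \<le> young_const p b"
  by (simp add: young_const_def)

text \<open>A form of Hoelder's inequality with a free scale \<open>l\<close>: when the weighted
  p-integral is at most \<open>l powr p\<close>, the whole right-hand side is at most
  \<open>l * (young_const p b + 1)\<close>, hence linear in \<open>l\<close>.\<close>

lemma young_integral_bound:
  assumes d[measurable]: "d \<in> borel_measurable halfline" and "p > 2" "l > 0" "b \<ge> 0"
  shows "(\<integral>\<^sup>+ r. ennreal \<bar>d r\<bar> * indicator {..b} r \<partial>halfline)
     \<le> ennreal (l * young_const p b) + ennreal (l powr (1 - p)) * (\<integral>\<^sup>+ r. ennreal (\<bar>d r\<bar> powr p * r) \<partial>halfline)"
proof -
  define a where "a = - 1 / (p - 1)"
  have a: "a > -1"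
    using assms by (simp add: a_def field_simps)
  have [measurable]: "indicator {..b} \<in> borel_measurable halfline"
    by (rule measurable_restrict_space1, rule measurable_completion) simp
  have "(\<integral>\<^sup>+ r. ennreal \<bar>d r\<bar> * indicator {..b} r \<partial>halfline) \<le>
     (\<integral>\<^sup>+ r. ennreal l * (ennreal (r powr a) * indicator {..b} r) + ennreal (l powr (1 - p)) * ennreal (\<bar>d r\<bar> powr p * r) \<partial>halfline)"
  proof (rule nn_integral_mono)
    fix r assume "r \<in> space halfline"
    then have r: "r > 0" by simp
    have "ennreal \<bar>d r\<bar> \<le> ennreal (l * r powr a + l powr (1 - p) * (\<bar>d r\<bar> powr p * r))"
      unfolding a_def using assms r by (intro ennreal_leI young_bound)
    also have "\<dots> = ennreal l * ennreal (r powr a) + ennreal (l powr (1 - p)) * ennreal (\<bar>d r\<bar> powr p * r)"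
      using assms r by (simp add: ennreal_plus ennreal_mult)
    finally show "ennreal \<bar>d r\<bar> * indicator {..b} r \<le> ennreal l * (ennreal (r powr a) * indicator {..b} r)
        + ennreal (l powr (1 - p)) * ennreal (\<bar>d r\<bar> powr p * r)"
      by (cases "r \<le> b") auto
  qed
  also have "\<dots> = ennreal l * (\<integral>\<^sup>+ r. ennreal (r powr a) * indicator {..b} r \<partial>halfline)
      + ennreal (l powr (1 - p)) * (\<integral>\<^sup>+ r. ennreal (\<bar>d r\<bar> powr p * r) \<partial>halfline)"
    by (subst nn_integral_add) (simp_all add: nn_integral_cmult)
  also have "(\<integral>\<^sup>+ r. ennreal (r powr a) * indicator {..b} r \<partial>halfline) = ennreal (young_const p b)"
  proof -
    have "(\<integral>\<^sup>+ r. ennreal (r powr a) * indicator {..b} r \<partial>halfline)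
      = (\<integral>\<^sup>+ r. ennreal (r powr a) * indicator {0..b} r \<partial>lborel)"
      unfolding nn_integral_halfline[symmetric] nn_integral_completion
      by (rule nn_integral_cong) (auto simp: indicator_def)
    also have "\<dots> = ennreal (b powr (a + 1) / (a + 1))"
      using assms a by (intro nn_integral_has_integral_lebesgue' has_integral_powr_from_0) auto
    also have "b powr (a + 1) / (a + 1) = young_const p b"
      by (simp add: young_const_def a_def)
    finally show ?thesis .
  qed
  also have "ennreal l * ennreal (young_const p b) = ennreal (l * young_const p b)"
    using assms young_const_nonneg by (simp add: ennreal_mult)
  finally show ?thesis .
qed

lemma absolutely_integrable_if_gradient_energy:
  assumes "p > 2" and g: "g \<in> borel_measurable halfline" and fin: "gradient_energy p f g < \<infinity>"
  shows "g absolutely_integrable_on {0..b}"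
proof (cases "b \<ge> 0")
  case True
  have "(\<integral>\<^sup>+ r. ennreal (\<bar>g r\<bar> powr p * r) \<partial>halfline) \<le> gradient_energy p f g"
    unfolding gradient_energy_def
    using \<open>p > 2\<close> by (intro nn_integral_mono ennreal_leI mult_right_mono powr_le_gradient_term) auto
  with fin have "(\<integral>\<^sup>+ r. ennreal (\<bar>g r\<bar> powr p * r) \<partial>halfline) < \<infinity>"
    by (rule le_less_trans[rotated])
  then show ?thesis
    using young_integral_bound[OF g \<open>p > 2\<close> zero_less_one True]
    by (intro absolutely_integrable_halflineI g) (auto simp: less_top[symmetric] top_unique)
qed simp

section \<open>Representatives of weakly differentiable functions\<close>

lemma compact_subset_pos:
  fixes K :: "real set"
  assumes "compact K" "K \<subseteq> {0<..}"
  obtains a b where "0 < a" "K \<subseteq> {a..b}"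
proof (cases "K = {}")
  case False
  obtain a where "a \<in> K" "\<forall>x\<in>K. a \<le> x"
    using compact_attains_inf[OF assms(1) False] by blast
  moreover obtain b where "b \<in> K" "\<forall>x\<in>K. x \<le> b"
    using compact_attains_sup[OF assms(1) False] by blast
  ultimately show ?thesis
    using assms(2) by (intro that[of a b]) auto
qed (use that[of 1] in auto)

lemma Lp_loc_halflineI:
  assumes "f \<in> borel_measurable halfline"
    and "\<And>a b. 0 < a \<Longrightarrow> (\<lambda>x. \<bar>f x\<bar> powr p) absolutely_integrable_on {a..b}"
  shows "Lp_loc {0<..} p f"
  unfolding Lp_loc_def
proof (intro conjI allI impI assms(1))
  fix K :: "real set" assume K: "compact K \<and> K \<subseteq> {0<..}"
  then obtain a b where "0 < a" "K \<subseteq> {a..b}"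
    using compact_subset_pos by blast
  moreover have "K \<in> sets lebesgue"
    using K by (simp add: compact_imp_closed)
  ultimately show "set_integrable lebesgue K (\<lambda>x. \<bar>f x\<bar> powr p)"
    by (intro set_integrable_subset[OF assms(2)])
qed

lemma Lp_loc_1_absolutely_integrable:
  assumes "Lp_loc {0<..} 1 u" "0 < a"
  shows "u absolutely_integrable_on {a..b}"
proof -
  have "u \<in> borel_measurable (lebesgue_on {a..b})"
    by (rule measurable_restrict_mono[where A="{0<..}"]) (use assms in \<open>auto simp: Lp_loc_def\<close>)
  moreover have "{a..b} \<subseteq> {0<..}"
    using assms(2) by auto
  then have "set_integrable lebesgue {a..b} (\<lambda>x. \<bar>u x\<bar> powr 1)"
    using assms unfolding Lp_loc_def by blast
  then have "(\<lambda>x. \<bar>u x\<bar>) integrable_on {a..b}"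
    using set_lebesgue_integral_eq_integral(1) by fastforce
  ultimately show ?thesis
    by (subst absolutely_integrable_measurable_real') auto
qed

lemma test_fun_support:
  assumes "test_fun {0<..} \<phi>"
  shows "\<exists>a b. 0 < a \<and> (\<forall>x. x \<notin> {a..b} \<longrightarrow> \<phi> x = 0) \<and> (\<forall>x. x \<notin> {a..b} \<longrightarrow> deriv \<phi> x = 0)"
proof -
  obtain K where K: "compact K" "K \<subseteq> {0<..}" "\<And>x. x \<notin> K \<Longrightarrow> \<phi> x = 0"
    using assms unfolding test_fun_def by blast
  obtain a b where ab: "0 < a" "K \<subseteq> {a..b}"
    using K compact_subset_pos by blast
  have zero: "\<phi> x = 0" if "x \<notin> {a..b}" for x
    using that ab K(3) by blast
  have "deriv \<phi> x = 0" if x: "x \<notin> {a..b}" for x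
  proof -
    have "((\<lambda>x. 0) has_real_derivative 0) (at x)"
      by simp
    then have "(\<phi> has_real_derivative 0) (at x)"
      by (rule has_field_derivative_transform_within_open[where S="{..<a} \<union> {b<..}"])
         (use x zero in \<open>auto intro!: open_Un\<close>)
    then show ?thesis
      by (rule DERIV_imp_deriv)
  qed
  with ab(1) zero show ?thesis
    by blast
qed

lemma set_integrable_mult_support:
  fixes u \<phi> :: "real \<Rightarrow> real"
  assumes u: "u absolutely_integrable_on {a..b}" and \<phi>: "continuous_on UNIV \<phi>"
    and supp: "\<And>x. x \<notin> {a..b} \<Longrightarrow> \<phi> x = 0" and "{a..b} \<subseteq> S"
  shows "set_integrable lebesgue S (\<lambda>x. u x * \<phi> x)"
    and "(LINT x:S|lebesgue. u x * \<phi> x) = integral {a..b} (\<lambda>x. u x * \<phi> x)"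
proof -
  have c: "continuous_on {a..b} \<phi>"
    using \<phi> continuous_on_subset by blast
  have "(\<lambda>x. \<phi> x * u x) absolutely_integrable_on {a..b}"
    using u compact_imp_bounded[OF compact_continuous_image[OF c]]
    by (intro absolutely_integrable_bounded_measurable_product_real
         continuous_imp_measurable_on_sets_lebesgue c) auto
  then have i: "(\<lambda>x. u x * \<phi> x) absolutely_integrable_on {a..b}"
    by (simp add: mult.commute)
  have eq: "indicator S x *\<^sub>R (u x * \<phi> x) = indicator {a..b} x *\<^sub>R (u x * \<phi> x)" for x
    using supp[of x] \<open>{a..b} \<subseteq> S\<close> by (auto simp: indicator_def)
  show "set_integrable lebesgue S (\<lambda>x. u x * \<phi> x)"
    using i unfolding set_integrable_def eq .
  show "(LINT x:S|lebesgue. u x * \<phi> x) = integral {a..b} (\<lambda>x. u x * \<phi> x)"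
    using set_lebesgue_integral_eq_integral(2)[OF i] unfolding set_lebesgue_integral_def eq .
qed

lemma test_fun_smooth: "test_fun S \<phi> \<Longrightarrow> smooth \<phi>"
  by (simp add: test_fun_iff_smooth)

lemma test_fun_integrable:
  assumes "Lp_loc {0<..} 1 u" "test_fun {0<..} \<phi>"
  shows "set_integrable lebesgue {0<..} (\<lambda>x. u x * \<phi> x)"
    "set_integrable lebesgue {0<..} (\<lambda>x. u x * deriv \<phi> x)"
proof -
  obtain a b where a: "0 < a" and supp: "\<forall>x. x \<notin> {a..b} \<longrightarrow> \<phi> x = 0" "\<forall>x. x \<notin> {a..b} \<longrightarrow> deriv \<phi> x = 0"
    using test_fun_support[OF assms(2)] by blast
  note ab = a supp[rule_format]
  have s: "smooth \<phi>"
    using assms(2) test_fun_smooth by blast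
  have u: "u absolutely_integrable_on {a..b}"
    using Lp_loc_1_absolutely_integrable[OF assms(1) ab(1)] .
  have "{a..b} \<subseteq> {0<..}"
    using ab(1) by auto
  then show "set_integrable lebesgue {0<..} (\<lambda>x. u x * \<phi> x)"
    "set_integrable lebesgue {0<..} (\<lambda>x. u x * deriv \<phi> x)"
    using set_integrable_mult_support(1)[OF u smooth_continuous_on[OF s] ab(2)]
      set_integrable_mult_support(1)[OF u smooth_continuous_on[OF smooth_deriv[OF s]] ab(3)] by auto
qed

lemma weak_deriv_unique:
  assumes "has_weak_deriv {0<..} f g1" "has_weak_deriv {0<..} f g2"
  shows "AE x in halfline. g1 x = g2 x"
proof -
  have L: "Lp_loc {0<..} 1 g1" "Lp_loc {0<..} 1 g2"
    using assms by (auto simp: has_weak_deriv_def)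
  have "AE x in lebesgue. x > 0 \<longrightarrow> g1 x - g2 x = 0"
  proof (rule fundamental_lemma_variations)
    show "(\<lambda>x. g1 x - g2 x) absolutely_integrable_on {a..b}" if "0 < a" for a b
      using L that by (intro set_integral_diff Lp_loc_1_absolutely_integrable)
    fix \<phi> assume \<phi>: "test_fun {0<..} \<phi>"
    have "(LINT x:{0<..}|lebesgue. (g1 x - g2 x) * \<phi> x)
        = (LINT x:{0<..}|lebesgue. g1 x * \<phi> x) - (LINT x:{0<..}|lebesgue. g2 x * \<phi> x)"
      unfolding left_diff_distrib by (intro set_integral_diff test_fun_integrable L \<phi>)
    moreover have "(LINT x:{0<..}|lebesgue. f x * deriv \<phi> x) = - (LINT x:{0<..}|lebesgue. g1 x * \<phi> x)"
      "(LINT x:{0<..}|lebesgue. f x * deriv \<phi> x) = - (LINT x:{0<..}|lebesgue. g2 x * \<phi> x)"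
      using assms \<phi> by (auto simp: has_weak_deriv_def)
    ultimately show "(LINT x:{0<..}|lebesgue. (g1 x - g2 x) * \<phi> x) = 0"
      by linarith
  qed
  then show ?thesis
    by (simp add: AE_halfline_iff)
qed

text \<open>The chosen representative can be traded for any known weak derivative, because the
  energies ignore null sets.\<close>

lemma weak_deriv_eq:
  assumes "has_weak_deriv {0<..} f g"
  shows "AE x in halfline. weak_deriv {0<..} f x = g x"
  using weak_deriv_unique[OF someI[of "has_weak_deriv {0<..} f", OF assms] assms]
  by (simp add: weak_deriv_def)

lemma smooth_primitive: "smooth \<phi> \<Longrightarrow> primitive \<phi> (deriv \<phi>)"
  unfolding primitive_def
proof (intro conjI allI impI)
  assume s: "smooth \<phi>"
  show "deriv \<phi> absolutely_integrable_on {0..b}" for b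
    by (intro absolutely_integrable_continuous_real smooth_continuous_on smooth_deriv s)
  fix x :: real assume "x \<ge> 0"
  then have "(deriv \<phi> has_integral (\<phi> x - \<phi> 0)) {0..x}"
    by (intro fundamental_theorem_of_calculus)
       (auto intro!: has_field_derivative_at_within smooth_has_real_derivative s
         simp flip: has_real_derivative_iff_has_vector_derivative)
  then show "\<phi> x = \<phi> 0 + integral {0..x} (deriv \<phi>)"
    by (simp add: integral_unique)
qed

text \<open>Integration by parts comes from the product rule for the function times a test function,
  whose boundary values vanish.\<close>

lemma primitive_has_weak_deriv:
  assumes "primitive f g"
  shows "has_weak_deriv {0<..} f g"
  unfolding has_weak_deriv_def
proof (intro conjI allI impI)
  have sub: "{a..b} \<subseteq> {0..b}" if "0 < a" for a b :: real
    using that by auto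
  have cf: "continuous_on {a..b} f" if "0 < a" for a b
    using that by (intro continuous_on_subset[OF primitive_continuous_on[OF assms]]) auto
  have gi: "g absolutely_integrable_on {a..b}" if "0 < a" for a b
    by (rule set_integrable_subset[OF primitive_absolutely_integrable[OF assms] _ sub[OF that]]) simp
  show "Lp_loc {0<..} 1 f"
    by (intro Lp_loc_halflineI primitive_measurable[OF assms])
       (auto intro!: absolutely_integrable_continuous_real continuous_intros cf)
  show "Lp_loc {0<..} 1 g"
    by (intro Lp_loc_halflineI primitive_measurable[OF assms]) (auto intro!: set_integrable_abs gi)
  fix \<phi> assume \<phi>: "test_fun {0<..} \<phi>"
  obtain a b where a: "0 < a" and supp: "\<forall>x. x \<notin> {a..b} \<longrightarrow> \<phi> x = 0" "\<forall>x. x \<notin> {a..b} \<longrightarrow> deriv \<phi> x = 0"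
    using test_fun_support[OF \<phi>] by blast
  note ab = a supp[rule_format]
  \<comment> \<open>A point to the right of 0 and of the support, whatever the sign of
    \<open>b\<close>.\<close>
  define B where "B = \<bar>b\<bar> + 1"
  have s: "smooth \<phi>"
    using \<phi> test_fun_smooth by blast
  have "{a..b} \<subseteq> {0<..}"
    using ab(1) by auto
  have 1: "(LINT x:{0<..}|lebesgue. f x * deriv \<phi> x) = integral {a..b} (\<lambda>x. f x * deriv \<phi> x)"
    "(\<lambda>x. f x * deriv \<phi> x) integrable_on {a..b}"
    using set_integrable_mult_support[OF absolutely_integrable_continuous_real[OF cf[OF ab(1)]]
        smooth_continuous_on[OF smooth_deriv[OF s]] ab(3)] \<open>{a..b} \<subseteq> {0<..}\<close>
    by (auto intro: set_lebesgue_integral_eq_integral(1))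
  have 2: "(LINT x:{0<..}|lebesgue. g x * \<phi> x) = integral {a..b} (\<lambda>x. g x * \<phi> x)"
    "(\<lambda>x. g x * \<phi> x) integrable_on {a..b}"
    using set_integrable_mult_support[OF gi[OF ab(1)] smooth_continuous_on[OF s] ab(2)] \<open>{a..b} \<subseteq> {0<..}\<close>
    by (auto intro: set_lebesgue_integral_eq_integral(1))
  have "f B * \<phi> B = f 0 * \<phi> 0 + integral {0..B} (\<lambda>x. g x * \<phi> x + f x * deriv \<phi> x)"
    by (rule primitive_eq[OF primitive_mult[OF assms smooth_primitive[OF s]]]) (simp add: B_def)
  moreover have "\<phi> B = 0" "\<phi> 0 = 0"
    using ab(1) by (auto intro!: ab(2) simp: B_def)
  moreover have "integral {0..B} (\<lambda>x. g x * \<phi> x + f x * deriv \<phi> x)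
      = integral {0..B} (\<lambda>x. if x \<in> {a..b} then g x * \<phi> x + f x * deriv \<phi> x else 0)"
    using ab by (intro integral_cong) auto
  moreover have "\<dots> = integral {a..b} (\<lambda>x. g x * \<phi> x + f x * deriv \<phi> x)"
    unfolding integral_restrict_Int using ab(1)
    by (intro arg_cong2[where f=integral]) (auto simp: B_def)
  moreover have "\<dots> = integral {a..b} (\<lambda>x. g x * \<phi> x) + integral {a..b} (\<lambda>x. f x * deriv \<phi> x)"
    by (rule integral_add[OF 2(2) 1(2)])
  ultimately show "(LINT x:{0<..}|lebesgue. f x * deriv \<phi> x) = - (LINT x:{0<..}|lebesgue. g x * \<phi> x)"
    using 1 2 by simp
qed

lemma primitive_in_X:
  assumes "p > 2" and prim: "primitive f g" and fin: "gradient_energy p f g < \<infinity>"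
  shows "f \<in> X p" "I p f = energy p f g"
proof -
  note [measurable] = primitive_measurable[OF prim]
  have wd: "has_weak_deriv {0<..} f g"
    using prim by (rule primitive_has_weak_deriv)
  note ae = weak_deriv_eq[OF wd]
  show "I p f = energy p f g"
    unfolding I_eq_energy by (rule energy_cong_AE(1)[OF _ ae]) simp
  have Lf: "Lp_loc {0<..} p f"
  proof (intro Lp_loc_halflineI primitive_measurable[OF prim] absolutely_integrable_continuous_real)
    fix a b :: real assume "0 < a"
    then have "continuous_on {a..b} f"
      by (intro continuous_on_subset[OF primitive_continuous_on[OF prim]]) auto
    then show "continuous_on {a..b} (\<lambda>x. \<bar>f x\<bar> powr p)"
      using \<open>p > 2\<close> by (intro continuous_on_powr' continuous_intros) auto
  qed
  have Lg: "Lp_loc {0<..} p g"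
  proof (intro Lp_loc_halflineI primitive_measurable[OF prim])
    fix a b :: real assume a: "0 < a"
    \<comment> \<open>The weight r degenerates at 0. Cutting off below \<open>a\<close> makes it at
      least \<open>a\<close>, and the gradient energy then bounds the unweighted integral with
      constant 1 / a.\<close>
    define d where "d r = \<bar>g r\<bar> powr p * indicator {a..} r" for r
    have "indicator {a..} \<in> borel_measurable halfline"
      by (rule measurable_restrict_space1, rule measurable_completion) simp
    then have [measurable]: "d \<in> borel_measurable halfline"
      unfolding d_def by measurable
    have "(\<integral>\<^sup>+ r. ennreal \<bar>d r\<bar> * indicator {..b} r \<partial>halfline)
      \<le> (\<integral>\<^sup>+ r. ennreal (1 / a) * ennreal (gradient_term p (f r) (g r) r * r) \<partial>halfline)"
    proof (rule nn_integral_mono)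
      fix r assume "r \<in> space halfline"
      then have "r > 0" by simp
      have "d r \<le> 1 / a * (gradient_term p (f r) (g r) r * r)"
      proof (cases "r \<ge> a")
        case True
        have "\<bar>g r\<bar> powr p * a \<le> gradient_term p (f r) (g r) r * r"
          using True a \<open>p > 2\<close> by (intro mult_mono powr_le_gradient_term) auto
        then show ?thesis
          using a True by (simp add: d_def field_simps)
      qed (use a \<open>r > 0\<close> in \<open>simp add: d_def\<close>)
      then have "ennreal \<bar>d r\<bar> \<le> ennreal (1 / a) * ennreal (gradient_term p (f r) (g r) r * r)"
        using a \<open>r > 0\<close> by (subst ennreal_mult[symmetric]) (auto simp: d_def intro!: ennreal_leI)
      then show "ennreal \<bar>d r\<bar> * indicator {..b} r \<le> ennreal (1 / a) * ennreal (gradient_term p (f r) (g r) r * r)"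
        by (auto simp: indicator_def)
    qed
    also have "\<dots> = ennreal (1 / a) * gradient_energy p f g"
      unfolding gradient_energy_def by (rule nn_integral_cmult) measurable
    also have "\<dots> < \<infinity>"
      using fin by (simp add: ennreal_mult_less_top)
    finally have "d absolutely_integrable_on {0..b}"
      by (intro absolutely_integrable_halflineI) auto
    then have "d absolutely_integrable_on {a..b}"
      by (rule set_integrable_subset) (use a in auto)
    then show "(\<lambda>x. \<bar>g x\<bar> powr p) absolutely_integrable_on {a..b}"
      unfolding set_integrable_def
      by (rule Bochner_Integration.integrable_cong[THEN iffD1, rotated -1]) (auto simp: d_def indicator_def)
  qed
  have "gradient_energy p f (weak_deriv {0<..} f) = gradient_energy p f g"
    by (rule energy_cong_AE(2)[OF _ ae]) simp
  then show "f \<in> X p"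
    unfolding X_def W1p_loc_def mem_Collect_eq gradient_energy_weak_deriv using Lf Lg wd fin by auto
qed

section \<open>Behaviour at the origin\<close>

lemma nn_integral_inverse_halfline:
  assumes "b > 0"
  shows "(\<integral>\<^sup>+ r. ennreal (1 / r) * indicator {..b} r \<partial>halfline) = \<infinity>"
proof (rule ccontr)
  assume "\<not> ?thesis"
  then have fin: "(\<integral>\<^sup>+ r. ennreal (1 / r) * indicator {..b} r \<partial>halfline) < \<infinity>"
    by (simp add: less_top)
  have "(\<integral>\<^sup>+ r. ennreal \<bar>1 / r\<bar> * indicator {..b} r \<partial>halfline) = (\<integral>\<^sup>+ r. ennreal (1 / r) * indicator {..b} r \<partial>halfline)"
    by (rule nn_integral_cong) simp
  with fin have "(\<lambda>r. 1 / r) absolutely_integrable_on {0..b}"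
    by (intro absolutely_integrable_halflineI) auto
  then have int: "(\<lambda>r. 1 / r) integrable_on {0..b}"
    by (rule set_lebesgue_integral_eq_integral)
  define J where "J = integral {0..b} (\<lambda>r. 1 / r)"
  \<comment> \<open>Chosen so that the integral of 1/r from \<open>a\<close> to \<open>b\<close> is
    |J| + 1, more than the supposed total \<open>J\<close>.\<close>
  define a where "a = b * exp (- (\<bar>J\<bar> + 1))"
  have a: "0 < a" "a \<le> b"
    using assms by (simp_all add: a_def)
  have "((\<lambda>r. 1 / r) has_integral (ln b - ln a)) {a..b}"
    using a by (intro fundamental_theorem_of_calculus)
      (auto intro!: derivative_eq_intros simp: divide_inverse simp flip: has_real_derivative_iff_has_vector_derivative)
  moreover have "ln b - ln a = \<bar>J\<bar> + 1"
    using assms by (simp add: a_def ln_mult)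
  ultimately have "\<bar>J\<bar> + 1 = integral {a..b} (\<lambda>r. 1 / r)" "(\<lambda>r. 1 / r) integrable_on {a..b}"
    by (auto simp: integral_unique)
  moreover have "integral {a..b} (\<lambda>r. 1 / r) \<le> J"
    unfolding J_def using a int calculation(2) by (intro integral_subset_le) auto
  ultimately show False
    by linarith
qed

text \<open>For r \<le> 1 and p \<ge> 2 one has r^(1 - p) \<ge> 1/r, so the term u/r alone forces
  the density above a multiple of 1/r wherever |u| stays away from 0.\<close>

lemma gradient_term_ge:
  assumes "p \<ge> 2" "0 < r" "r \<le> 1" "0 \<le> k" "k \<le> \<bar>u\<bar>"
  shows "k powr p * (1 / r) \<le> gradient_term p u v r * r"
proof -
  have "(1 / r) powr 2 * r = 1 / r"
    using assms(2) by (simp add: powr_numeral power2_eq_square)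
  moreover have "(1 / r) powr 2 \<le> (1 / r) powr p"
    using assms by (intro powr_mono) auto
  ultimately have "1 / r \<le> (1 / r) powr p * r"
    using assms(2) by (metis mult_right_mono less_imp_le)
  then have "k powr p * (1 / r) \<le> k powr p * ((1 / r) powr p * r)"
    by (rule mult_left_mono) simp
  moreover have "k powr p * ((1 / r) powr p * r) = (k * (1 / r)) powr p * r"
    using assms by (subst powr_mult) (auto simp: mult.assoc)
  moreover have "(k * (1 / r)) powr p \<le> \<bar>u / r\<bar> powr p"
    using assms by (intro powr_mono2) (auto simp: divide_right_mono)
  then have "(k * (1 / r)) powr p * r \<le> gradient_term p u v r * r"
    using powr_le_gradient_term(2)[of p u r v] assms by (intro mult_right_mono) auto
  ultimately show ?thesis
    by linarith
qed

text \<open>The integral of the weak derivative from 0 differs from h by a constant c almost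
  everywhere. If c were nonzero, h would stay away from 0 near the origin, and its gradient energy
  would dominate a multiple of the divergent integral of 1/r.\<close>

lemma X_obtains_primitive:
  assumes "p > 2" and h: "h \<in> X p"
  obtains f g where "primitive f g" "f 0 = 0" "energy p f g = I p h"
proof -
  define g where "g = weak_deriv {0<..} h"
  obtain g0 where "has_weak_deriv {0<..} h g0"
    using h by (auto simp: X_def W1p_loc_def)
  then have wd: "has_weak_deriv {0<..} h g"
    unfolding g_def weak_deriv_def by (rule someI[of "has_weak_deriv {0<..} h"])
  have fin: "gradient_energy p h g < \<infinity>"
    using h by (simp add: X_def g_def flip: gradient_energy_weak_deriv)
  have Lh: "Lp_loc {0<..} 1 h" and Lg: "Lp_loc {0<..} 1 g"
    using wd by (auto simp: has_weak_deriv_def)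
  then have gm: "g \<in> borel_measurable halfline"
    by (simp add: Lp_loc_def)
  have gi: "g absolutely_integrable_on {0..b}" for b
    using absolutely_integrable_if_gradient_energy[OF \<open>p > 2\<close> gm fin] .
  define f where "f x = integral {0..x} g" for x
  have prim: "primitive f g"
    using gi by (simp add: primitive_def f_def)
  then have wdf: "has_weak_deriv {0<..} f g"
    by (rule primitive_has_weak_deriv)
  then have Lf: "Lp_loc {0<..} 1 f"
    by (simp add: has_weak_deriv_def)
  obtain c where c: "AE x in lebesgue. x > 0 \<longrightarrow> h x - f x = c"
  proof (rule du_Bois_Reymond)
    show "(\<lambda>x. h x - f x) absolutely_integrable_on {a..b}" if "0 < a" for a b
      using Lh Lf that by (intro set_integral_diff Lp_loc_1_absolutely_integrable)
    fix \<phi> assume \<phi>: "test_fun {0<..} \<phi>"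
    have "(LINT x:{0<..}|lebesgue. (h x - f x) * deriv \<phi> x)
        = (LINT x:{0<..}|lebesgue. h x * deriv \<phi> x) - (LINT x:{0<..}|lebesgue. f x * deriv \<phi> x)"
      unfolding left_diff_distrib by (intro set_integral_diff test_fun_integrable Lh Lf \<phi>)
    then show "(LINT x:{0<..}|lebesgue. (h x - f x) * deriv \<phi> x) = 0"
      using wd wdf \<phi> by (simp add: has_weak_deriv_def)
  qed
  then have c': "AE x in halfline. h x = f x + c"
    unfolding AE_halfline_iff by eventually_elim auto
  have "c = 0"
  proof (rule ccontr)
    assume "c \<noteq> 0"
    have "\<bar>c\<bar> / 2 > 0"
      using \<open>c \<noteq> 0\<close> by simp
    then obtain d where d: "d > 0" "\<forall>x\<in>{0..}. dist x 0 < d \<longrightarrow> dist (f x) (f 0) < \<bar>c\<bar> / 2"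
      using primitive_continuous_on[OF prim, unfolded continuous_on_iff, rule_format, of 0 "\<bar>c\<bar> / 2"] by (meson atLeast_iff order_refl)
    \<comment> \<open>On (0, b] continuity and \<open>f 0 = 0\<close> give |f| < |c| / 2; the bound
      b \<le> 1 is what \<open>gradient_term_ge\<close> asks for.\<close>
    define b where "b = min (d / 2) 1"
    have b: "0 < b" "b < d" "b \<le> 1"
      using d(1) by (auto simp: b_def)
    have "(\<integral>\<^sup>+ r. ennreal ((\<bar>c\<bar> / 2) powr p) * (ennreal (1 / r) * indicator {..b} r) \<partial>halfline) 
        \<le> gradient_energy p (\<lambda>x. f x + c) g"
      unfolding gradient_energy_def
    proof (rule nn_integral_mono)
      fix r assume "r \<in> space halfline"
      then have r: "r > 0" by simp
      show "ennreal ((\<bar>c\<bar> / 2) powr p) * (ennreal (1 / r) * indicator {..b} r) 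
          \<le> ennreal (gradient_term p (f r + c) (g r) r * r)"
      proof (cases "r \<le> b")
        case True
        have "\<bar>f r\<bar> < \<bar>c\<bar> / 2"
          using d(2)[rule_format, of r] r True b by (simp add: f_def dist_real_def)
        then have "\<bar>c\<bar> / 2 \<le> \<bar>f r + c\<bar>"
          by linarith
        then have "(\<bar>c\<bar> / 2) powr p * (1 / r) \<le> gradient_term p (f r + c) (g r) r * r"
          using r True b \<open>p > 2\<close> by (intro gradient_term_ge) auto
        then have "ennreal ((\<bar>c\<bar> / 2) powr p * (1 / r)) \<le> ennreal (gradient_term p (f r + c) (g r) r * r)"
          by (rule ennreal_leI)
        also have "ennreal ((\<bar>c\<bar> / 2) powr p * (1 / r)) = ennreal ((\<bar>c\<bar> / 2) powr p) * ennreal (1 / r)"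
          using r by (intro ennreal_mult) auto
        finally show ?thesis
          using True by simp
      qed simp
    qed
    moreover have "gradient_energy p (\<lambda>x. f x + c) g = gradient_energy p h g"
      by (rule energy_cong_AE(2)[symmetric, OF c']) simp
    moreover have "(\<integral>\<^sup>+ r. ennreal ((\<bar>c\<bar> / 2) powr p) * (ennreal (1 / r) * indicator {..b} r) \<partial>halfline)
        = ennreal ((\<bar>c\<bar> / 2) powr p) * \<infinity>"
    proof -
      have [measurable]: "indicator {..b} \<in> borel_measurable halfline"
        by (rule measurable_restrict_space1, rule measurable_completion) simp
      show ?thesis
        unfolding nn_integral_inverse_halfline[OF b(1), symmetric] by (rule nn_integral_cmult) measurable
    qed
    ultimately show False
      using \<open>c \<noteq> 0\<close> fin by (simp add: ennreal_mult_top top_unique)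
  qed
  from c' have "AE x in halfline. f x = h x"
    by eventually_elim (simp add: \<open>c = 0\<close>)
  then have "energy p f g = energy p h g"
    by (rule energy_cong_AE(1)) simp
  then show thesis
    using prim by (intro that[of f g]) (simp_all add: f_def I_eq_energy g_def)
qed

section \<open>Convexity of the energy\<close>

text \<open>After division by the sum both arguments lie in [0, 1], where raising to a power q \<ge>
  1 can only decrease them, and they add up to 1.\<close>

lemma powr_superadditive:
  fixes a b q :: real
  assumes "0 \<le> a" "0 \<le> b" "1 \<le> q"
  shows "a powr q + b powr q \<le> (a + b) powr q"
proof (cases "a + b = 0")
  case False
  define s where "s = a + b"
  have s: "s > 0"
    using False assms by (simp add: s_def)
  have *: "x powr q \<le> x / s * s powr q" if "0 \<le> x" "x \<le> s" for x
  proof -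
    have "(x / s) powr q \<le> x / s"
      using that s assms(3) powr_mono'[of 1 q "x / s"] by (simp add: divide_le_eq)
    then have "(x / s) powr q * s powr q \<le> x / s * s powr q"
      by (rule mult_right_mono) simp
    moreover have "(x / s) powr q * s powr q = x powr q"
      using that s by (subst powr_mult[symmetric]) auto
    ultimately show ?thesis by simp
  qed
  have "a powr q + b powr q \<le> a / s * s powr q + b / s * s powr q"
    using assms by (intro add_mono *) (auto simp: s_def)
  also have "\<dots> = s powr q"
    using s by (simp add: s_def flip: distrib_right add_divide_distrib)
  finally show ?thesis
    by (simp add: s_def)
next
  case True
  then have "a = 0" "b = 0"
    using assms by auto
  then show ?thesis by simp
qed

text \<open>Convexity of the power for positive arguments; when one argument is 0, the inequality is
  superadditivity applied to two equal halves.\<close>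

lemma powr_mean_le:
  fixes a b q :: real
  assumes "0 \<le> a" "0 \<le> b" "1 \<le> q"
  shows "((a + b) / 2) powr q \<le> (a powr q + b powr q) / 2"
proof (cases "a = 0 \<or> b = 0")
  case True
  then show ?thesis
    using powr_superadditive[of "(a + b) / 2" "(a + b) / 2" q] assms by auto
next
  case False
  then show ?thesis
    using convex_onD[OF powr_convex[OF assms(3)], of "1 / 2" a b] assms by (simp add: add_divide_distrib)
qed

text \<open>Cauchy-Schwarz bounds the squared derivative of the root mean square by the mean of the
  squares, and convexity of t^(p/2) does the rest. Where both functions vanish, the quotient is 0 by
  convention.\<close>

lemma gradient_term_rms:
  assumes "p \<ge> 2"
  defines "w \<equiv> \<lambda>a b :: real. sqrt ((a\<^sup>2 + b\<^sup>2) / 2)"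
  shows "gradient_term p (w a b) ((a * a' + b * b') / (2 * w a b)) r
       \<le> (gradient_term p a a' r + gradient_term p b b' r) / 2"
proof -
  have w2: "(w a b)\<^sup>2 = (a\<^sup>2 + b\<^sup>2) / 2"
    by (simp add: w_def)
  have "((a * a' + b * b') / (2 * w a b))\<^sup>2 \<le> (a'\<^sup>2 + b'\<^sup>2) / 2"
  proof (cases "a\<^sup>2 + b\<^sup>2 = 0")
    case False
    then have pos: "a\<^sup>2 + b\<^sup>2 > 0"
      by (simp add: less_le)
    \<comment> \<open>Lagrange's identity, which gives Cauchy-Schwarz in the plane with an explicit
      remainder.\<close>
    have "(a\<^sup>2 + b\<^sup>2) * (a'\<^sup>2 + b'\<^sup>2) - (a * a' + b * b')\<^sup>2 = (a * b' - b * a')\<^sup>2"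
      by (simp add: power2_eq_square algebra_simps)
    then have le: "(a * a' + b * b')\<^sup>2 \<le> (a\<^sup>2 + b\<^sup>2) * (a'\<^sup>2 + b'\<^sup>2)"
      using zero_le_power2[of "a * b' - b * a'"] by linarith
    have "((a * a' + b * b') / (2 * w a b))\<^sup>2 = (a * a' + b * b')\<^sup>2 / (2 * w a b)\<^sup>2"
      by (rule power_divide)
    also have "(2 * w a b)\<^sup>2 = 2 * (a\<^sup>2 + b\<^sup>2)"
      by (simp add: power_mult_distrib w2)
    also have "(a * a' + b * b')\<^sup>2 / (2 * (a\<^sup>2 + b\<^sup>2)) \<le> ((a\<^sup>2 + b\<^sup>2) * (a'\<^sup>2 + b'\<^sup>2)) / (2 * (a\<^sup>2 + b\<^sup>2))"
      using le pos by (intro divide_right_mono) auto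
    also have "\<dots> = (a'\<^sup>2 + b'\<^sup>2) / 2"
    proof -
      have "S * T / (2 * S) = T / 2" if "S > 0" for S T :: real
        using that by simp
      from this[OF pos] show ?thesis .
    qed
    finally show ?thesis .
  qed (auto simp: sum_power2_eq_zero_iff)
  then have "gradient_term p (w a b) ((a * a' + b * b') / (2 * w a b)) r
      \<le> (((a'\<^sup>2 + a\<^sup>2 / r\<^sup>2) + (b'\<^sup>2 + b\<^sup>2 / r\<^sup>2)) / 2) powr (p / 2)"
    unfolding gradient_term_def w2 using assms(1)
    by (intro powr_mono2) (auto simp: add_divide_distrib)
  also have "\<dots> \<le> (gradient_term p a a' r + gradient_term p b b' r) / 2"
    unfolding gradient_term_def using assms(1) by (intro powr_mean_le) auto
  finally show ?thesis .
qed

text \<open>The parallelogram law for the vectors (v, u/r) is an equality; superadditivity of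
  t^(p/2) splits one side of it and convexity bounds the other. Both use p/2 \<ge> 1.\<close>

lemma gradient_term_clarkson:
  assumes "p \<ge> 2"
  shows "gradient_term p ((a + b) / 2) ((a' + b') / 2) r + gradient_term p ((a - b) / 2) ((a' - b') / 2) r
       \<le> (gradient_term p a a' r + gradient_term p b b' r) / 2"
proof -
  let ?N = "\<lambda>u v. v\<^sup>2 + u\<^sup>2 / r\<^sup>2"
  have "?N ((a + b) / 2) ((a' + b') / 2) + ?N ((a - b) / 2) ((a' - b') / 2) = (?N a a' + ?N b b') / 2"
  proof -
    have *: "((x + y) / 2)\<^sup>2 + ((x - y) / 2)\<^sup>2 = (x\<^sup>2 + y\<^sup>2) / 2" for x y :: real
      by (simp add: power2_eq_square field_simps)
    have "?N ((a + b) / 2) ((a' + b') / 2) + ?N ((a - b) / 2) ((a' - b') / 2)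
      = (((a' + b') / 2)\<^sup>2 + ((a' - b') / 2)\<^sup>2) + (((a + b) / 2)\<^sup>2 + ((a - b) / 2)\<^sup>2) / r\<^sup>2"
      by (simp only: add_divide_distrib add_ac)
    then show ?thesis
      unfolding * by (simp add: add_divide_distrib)
  qed
  moreover have "gradient_term p ((a + b) / 2) ((a' + b') / 2) r + gradient_term p ((a - b) / 2) ((a' - b') / 2) r
      \<le> (?N ((a + b) / 2) ((a' + b') / 2) + ?N ((a - b) / 2) ((a' - b') / 2)) powr (p / 2)"
    unfolding gradient_term_def using assms by (intro powr_superadditive) auto
  ultimately have "gradient_term p ((a + b) / 2) ((a' + b') / 2) r + gradient_term p ((a - b) / 2) ((a' - b') / 2) r
      \<le> ((?N a a' + ?N b b') / 2) powr (p / 2)"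
    by (simp only:)
  also have "\<dots> \<le> (gradient_term p a a' r + gradient_term p b b' r) / 2"
    unfolding gradient_term_def using assms by (intro powr_mean_le) auto
  finally show ?thesis .
qed

text \<open>The parallelogram law for 1 - a^2 and 1 - b^2: the root mean square is the midpoint in
  the variable \<open>u\<close>.\<close>

lemma potential_rms:
  fixes a b :: real
  shows "(1 - (sqrt ((a\<^sup>2 + b\<^sup>2) / 2))\<^sup>2)\<^sup>2 + (a\<^sup>2 - b\<^sup>2)\<^sup>2 / 4 = ((1 - a\<^sup>2)\<^sup>2 + (1 - b\<^sup>2)\<^sup>2) / 2"
proof -
  have "(sqrt ((a\<^sup>2 + b\<^sup>2) / 2))\<^sup>2 = (a\<^sup>2 + b\<^sup>2) / 2"
    by simp
  then show ?thesis
    by (simp only:) (simp add: power2_eq_square field_simps)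
qed

text \<open>At the midpoint the argument of the potential exceeds the one at the root mean square by
  d = ((a - b) / 2)^2. A weighted Young inequality separates d, and a, b \<ge> 0 gives (a - b)^2
  \<le> |a^2 - b^2|, so d is controlled by the squares.\<close>

lemma potential_mean:
  fixes a b e :: real
  assumes "0 \<le> a" "0 \<le> b" "0 < e"
  shows "(1 - ((a + b) / 2)\<^sup>2)\<^sup>2 \<le> (1 + e) * (((1 - a\<^sup>2)\<^sup>2 + (1 - b\<^sup>2)\<^sup>2) / 2) + (1 + 1 / e) * ((a\<^sup>2 - b\<^sup>2)\<^sup>2 / 16)"
proof -
  define c where "c = 1 - (a\<^sup>2 + b\<^sup>2) / 2"
  define d where "d = ((a - b) / 2)\<^sup>2"
  have cd: "1 - ((a + b) / 2)\<^sup>2 = c + d"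
    by (simp add: c_def d_def power2_eq_square field_simps)
  have "(c + d)\<^sup>2 \<le> (1 + e) * c\<^sup>2 + (1 + 1 / e) * d\<^sup>2"
  proof -
    have "(1 + e) * c\<^sup>2 + (1 + 1 / e) * d\<^sup>2 - (c + d)\<^sup>2 = e * (c - d / e)\<^sup>2"
      using assms(3) by (simp add: power2_eq_square field_simps)
    moreover have "0 \<le> e * (c - d / e)\<^sup>2"
      using assms(3) by simp
    ultimately show ?thesis by linarith
  qed
  moreover have "c\<^sup>2 \<le> ((1 - a\<^sup>2)\<^sup>2 + (1 - b\<^sup>2)\<^sup>2) / 2"
  proof -
    have "c\<^sup>2 + (a\<^sup>2 - b\<^sup>2)\<^sup>2 / 4 = ((1 - a\<^sup>2)\<^sup>2 + (1 - b\<^sup>2)\<^sup>2) / 2"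
      by (simp add: c_def power2_eq_square field_simps)
    then show ?thesis
      using zero_le_power2[of "a\<^sup>2 - b\<^sup>2"] by linarith
  qed
  then have "(1 + e) * c\<^sup>2 \<le> (1 + e) * (((1 - a\<^sup>2)\<^sup>2 + (1 - b\<^sup>2)\<^sup>2) / 2)"
    using assms(3) by (intro mult_left_mono) auto
  moreover have "d\<^sup>2 \<le> (a\<^sup>2 - b\<^sup>2)\<^sup>2 / 16"
  proof -
    have "(a - b)\<^sup>2 \<le> \<bar>a\<^sup>2 - b\<^sup>2\<bar>"
    proof -
      have "\<bar>a - b\<bar> * \<bar>a - b\<bar> \<le> \<bar>a - b\<bar> * (a + b)"
        using assms by (intro mult_left_mono) auto
      also have "\<dots> = \<bar>(a - b) * (a + b)\<bar>"
        using assms by (simp add: abs_mult)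
      also have "(a - b) * (a + b) = a\<^sup>2 - b\<^sup>2"
        by (simp add: power2_eq_square algebra_simps)
      finally show ?thesis
        by (simp add: power2_eq_square)
    qed
    then have "((a - b)\<^sup>2)\<^sup>2 \<le> (a\<^sup>2 - b\<^sup>2)\<^sup>2"
      by (metis abs_le_square_iff abs_power2)
    then show ?thesis
      by (simp add: d_def power_divide)
  qed
  then have "(1 + 1 / e) * d\<^sup>2 \<le> (1 + 1 / e) * ((a\<^sup>2 - b\<^sup>2)\<^sup>2 / 16)"
    using assms(3) by (intro mult_left_mono) auto
  ultimately show ?thesis
    unfolding cd by linarith
qed

section \<open>Comparison of near-minimisers with their root mean square and midpoint\<close>

lemma nn_integral_halfline_ineq:
  assumes [measurable]: "a \<in> borel_measurable halfline" "b \<in> borel_measurable halfline"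
     "c \<in> borel_measurable halfline" "d \<in> borel_measurable halfline" "e \<in> borel_measurable halfline"
    and nonneg: "\<And>r. r > 0 \<Longrightarrow> 0 \<le> a r" "\<And>r. r > 0 \<Longrightarrow> 0 \<le> b r" "\<And>r. r > 0 \<Longrightarrow> 0 \<le> c r"
      "\<And>r. r > 0 \<Longrightarrow> 0 \<le> d r" "\<And>r. r > 0 \<Longrightarrow> 0 \<le> e r"
    and "0 \<le> s" "0 \<le> t"
    and le: "\<And>r. r > 0 \<Longrightarrow> a r + b r \<le> s * (c r + d r) + t * e r"
  shows "(\<integral>\<^sup>+ r. ennreal (a r) \<partial>halfline) + (\<integral>\<^sup>+ r. ennreal (b r) \<partial>halfline)
     \<le> ennreal s * ((\<integral>\<^sup>+ r. ennreal (c r) \<partial>halfline) + (\<integral>\<^sup>+ r. ennreal (d r) \<partial>halfline))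
       + ennreal t * (\<integral>\<^sup>+ r. ennreal (e r) \<partial>halfline)"
proof -
  have "(\<integral>\<^sup>+ r. ennreal (a r) \<partial>halfline) + (\<integral>\<^sup>+ r. ennreal (b r) \<partial>halfline)
      = (\<integral>\<^sup>+ r. ennreal (a r) + ennreal (b r) \<partial>halfline)"
    by (rule nn_integral_add[symmetric]) measurable
  also have "\<dots> \<le> (\<integral>\<^sup>+ r. ennreal s * (ennreal (c r) + ennreal (d r)) + ennreal t * ennreal (e r) \<partial>halfline)"
  proof (rule nn_integral_mono)
    fix r assume "r \<in> space halfline"
    then have r: "r > 0" by simp
    have "ennreal (a r) + ennreal (b r) = ennreal (a r + b r)"
      using nonneg r by simp
    also have "\<dots> \<le> ennreal (s * (c r + d r) + t * e r)"
      using le[OF r] by (rule ennreal_leI)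
    also have "\<dots> = ennreal s * (ennreal (c r) + ennreal (d r)) + ennreal t * ennreal (e r)"
      using nonneg r assms(11,12) by (simp add: ennreal_mult)
    finally show "ennreal (a r) + ennreal (b r) \<le> ennreal s * (ennreal (c r) + ennreal (d r)) + ennreal t * ennreal (e r)" .
  qed
  also have "\<dots> = ennreal s * ((\<integral>\<^sup>+ r. ennreal (c r) \<partial>halfline) + (\<integral>\<^sup>+ r. ennreal (d r) \<partial>halfline))
       + ennreal t * (\<integral>\<^sup>+ r. ennreal (e r) \<partial>halfline)"
    by (simp add: nn_integral_add nn_integral_cmult)
  finally show ?thesis .
qed

text \<open>Both competitors have energy at least m, so whatever the convexity estimates gain over m
  is bounded. The root mean square yields smallness of the difference of the squares, which is then
  the price for using the midpoint. The parameter \<open>t\<close> balances the two errors of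
  \<open>potential_mean\<close>.\<close>

lemma gradient_energy_diff_le:
  assumes "p > 2" and m: "0 \<le> m" "\<And>f f'. primitive f f' \<Longrightarrow> f 0 = 0 \<Longrightarrow> ennreal m \<le> energy p f f'"
    and f: "primitive f f'" "f 0 = 0" "\<And>x. x > 0 \<Longrightarrow> 0 \<le> f x" "energy p f f' \<le> ennreal (m + e)"
    and g: "primitive g g'" "g 0 = 0" "\<And>x. x > 0 \<Longrightarrow> 0 \<le> g x" "energy p g g' \<le> ennreal (m + e)"
    and "0 < e" "0 < t"
  shows "gradient_energy p (\<lambda>x. (f x - g x) / 2) (\<lambda>x. (f' x - g' x) / 2)
       \<le> ennreal (t * (m + e) + e + (1 + 1 / t) * (e / 4))"
proof -
  note [measurable] = primitive_measurable[OF f(1)] primitive_measurable[OF g(1)]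
  define w where "w x = sqrt (((f x)\<^sup>2 + (g x)\<^sup>2) / 2)" for x
  define w' where "w' x = (f x * f' x + g x * g' x) / (2 * w x)" for x
  have w: "primitive w w'"
    unfolding w_def w'_def by (rule primitive_rms[OF f(1) g(1)])
  note [measurable] = primitive_measurable[OF w]
  \<comment> \<open>The weight 1/8 is the factor 1/2 of the potential times the 1/4 in
    \<open>potential_rms\<close>.\<close>
  define D where "D = (\<integral>\<^sup>+ r. ennreal (((f r)\<^sup>2 - (g r)\<^sup>2)\<^sup>2 / 8 * r) \<partial>halfline)"
  have sum: "ennreal c * (energy p f f' + energy p g g') \<le> ennreal (2 * c * (m + e))" if "c \<ge> 0" for c
  proof -
    have "ennreal c * (energy p f f' + energy p g g') \<le> ennreal c * (ennreal (m + e) + ennreal (m + e))"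
      by (intro mult_left_mono add_mono f g) auto
    also have "\<dots> = ennreal (2 * c * (m + e))"
      using that m(1) \<open>0 < e\<close> by (simp add: algebra_simps flip: ennreal_plus ennreal_mult)
    finally show ?thesis .
  qed
  have "energy p w w' + D \<le> ennreal (1 / 2) * (energy p f f' + energy p g g') + ennreal 0 * (\<integral>\<^sup>+ r. ennreal 0 \<partial>halfline)"
    unfolding energy_def D_def
  proof (rule nn_integral_halfline_ineq)
    fix r :: real assume "r > 0"
    have arith: "G + 1 / 2 * W + E / 8 \<le> 1 / 2 * ((A + 1 / 2 * P) + (B + 1 / 2 * Q))"
      if "G \<le> (A + B) / 2" "W + E / 4 = (P + Q) / 2" for G W E A B P Q :: real
      using that by argo
    have "gradient_term p (w r) (w' r) r \<le> (gradient_term p (f r) (f' r) r + gradient_term p (g r) (g' r) r) / 2"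
      unfolding w_def w'_def using \<open>p > 2\<close> by (intro gradient_term_rms) auto
    moreover have "(1 - (w r)\<^sup>2)\<^sup>2 + ((f r)\<^sup>2 - (g r)\<^sup>2)\<^sup>2 / 4 = ((1 - (f r)\<^sup>2)\<^sup>2 + (1 - (g r)\<^sup>2)\<^sup>2) / 2"
      unfolding w_def by (rule potential_rms)
    ultimately have "(gradient_term p (w r) (w' r) r + 1 / 2 * (1 - (w r)\<^sup>2)\<^sup>2) + ((f r)\<^sup>2 - (g r)\<^sup>2)\<^sup>2 / 8
        \<le> 1 / 2 * ((gradient_term p (f r) (f' r) r + 1 / 2 * (1 - (f r)\<^sup>2)\<^sup>2)
          + (gradient_term p (g r) (g' r) r + 1 / 2 * (1 - (g r)\<^sup>2)\<^sup>2))"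
      by (rule arith)
    from mult_right_mono[OF this, of r]
    show "(gradient_term p (w r) (w' r) r + 1 / 2 * (1 - (w r)\<^sup>2)\<^sup>2) * r + ((f r)\<^sup>2 - (g r)\<^sup>2)\<^sup>2 / 8 * r
        \<le> 1 / 2 * ((gradient_term p (f r) (f' r) r + 1 / 2 * (1 - (f r)\<^sup>2)\<^sup>2) * r
          + (gradient_term p (g r) (g' r) r + 1 / 2 * (1 - (g r)\<^sup>2)\<^sup>2) * r) + 0 * 0"
      using \<open>r > 0\<close> by (simp only: distrib_right distrib_left mult.assoc mult_zero_left add_0_right)
  qed (simp_all, measurable)
  also have "\<dots> \<le> ennreal (m + e)"
    using sum[of "1 / 2"] by simp
  finally have "energy p w w' + D \<le> ennreal m + ennreal e"
    using m(1) \<open>0 < e\<close> by simp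
  \<comment> \<open>The root mean square vanishes at 0 and is thus admissible; cancelling the finite
    m leaves \<open>D\<close> \<le> e.\<close>
  moreover have "ennreal m \<le> energy p w w'"
    using m(2)[OF w] by (simp add: w_def f g)
  ultimately have "ennreal m + D \<le> ennreal m + ennreal e"
    by (meson add_right_mono order_trans)
  then have D: "D \<le> ennreal e"
    by (simp add: ennreal_add_left_cancel_le)
  define h where "h x = (f x + g x) / 2" for x
  define h' where "h' x = (f' x + g' x) / 2" for x
  have h: "primitive h h'"
    using primitive_linear_combination[OF f(1) g(1), of "1 / 2" "1 / 2"]
    by (simp add: h_def[abs_def] h'_def[abs_def] add_divide_distrib)
  note [measurable] = primitive_measurable[OF h]
  let ?G = "gradient_energy p (\<lambda>x. (f x - g x) / 2) (\<lambda>x. (f' x - g' x) / 2)"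
  \<comment> \<open>The gradient part is enlarged by the factor 1 + t, required only by the
    potential, so that both share one prefactor. In the last coefficient 1/4 * 1/8 = 1/2 * 1/16
    converts the remainder of \<open>potential_mean\<close> into \<open>D\<close>.\<close>
  have "energy p h h' + ?G \<le> ennreal ((1 + t) / 2) * (energy p f f' + energy p g g') + ennreal ((1 + 1 / t) / 4) * D"
    unfolding energy_def D_def gradient_energy_def
  proof (rule nn_integral_halfline_ineq)
    fix r :: real assume r: "r > 0"
    have "gradient_term p (h r) (h' r) r + gradient_term p ((f r - g r) / 2) ((f' r - g' r) / 2) r
        \<le> (gradient_term p (f r) (f' r) r + gradient_term p (g r) (g' r) r) / 2"
      unfolding h_def h'_def using \<open>p > 2\<close> by (intro gradient_term_clarkson) auto
    also have "\<dots> \<le> (1 + t) * ((gradient_term p (f r) (f' r) r + gradient_term p (g r) (g' r) r) / 2)"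
      using \<open>0 < t\<close> mult_right_mono[of 1 "1 + t" "(gradient_term p (f r) (f' r) r + gradient_term p (g r) (g' r) r) / 2"]
      by (simp only: mult_1_left) simp
    finally have 1: "gradient_term p (h r) (h' r) r + gradient_term p ((f r - g r) / 2) ((f' r - g' r) / 2) r \<le> \<dots>" .
    have 2: "(1 - (h r)\<^sup>2)\<^sup>2 \<le> (1 + t) * (((1 - (f r)\<^sup>2)\<^sup>2 + (1 - (g r)\<^sup>2)\<^sup>2) / 2) + (1 + 1 / t) * (((f r)\<^sup>2 - (g r)\<^sup>2)\<^sup>2 / 16)"
      unfolding h_def by (intro potential_mean f g r \<open>0 < t\<close>)
    define A B where "A = gradient_term p (f r) (f' r) r" and "B = gradient_term p (g r) (g' r) r"
    define P Q where "P = (1 - (f r)\<^sup>2)\<^sup>2" and "Q = (1 - (g r)\<^sup>2)\<^sup>2"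
    define E where "E = ((f r)\<^sup>2 - (g r)\<^sup>2)\<^sup>2"
    have arith: "(G + 1 / 2 * W) + H \<le> K + 1 / 2 * L" if "G + H \<le> K" "W \<le> L" for G W H K L :: real
      using that by argo
    have eq: "(1 + t) * ((A + B) / 2) + 1 / 2 * ((1 + t) * ((P + Q) / 2) + (1 + 1 / t) * (E / 16))
       = (1 + t) / 2 * ((A + 1 / 2 * P) + (B + 1 / 2 * Q)) + (1 + 1 / t) / 4 * (E / 8)"
      by argo
    have "(gradient_term p (h r) (h' r) r + 1 / 2 * (1 - (h r)\<^sup>2)\<^sup>2) + gradient_term p ((f r - g r) / 2) ((f' r - g' r) / 2) r
        \<le> (1 + t) / 2 * ((A + 1 / 2 * P) + (B + 1 / 2 * Q)) + (1 + 1 / t) / 4 * (E / 8)"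
      unfolding eq[symmetric]
      by (rule arith[OF 1[folded A_def B_def] 2[folded P_def Q_def E_def]])
    from mult_right_mono[OF this, of r]
    show "(gradient_term p (h r) (h' r) r + 1 / 2 * (1 - (h r)\<^sup>2)\<^sup>2) * r + gradient_term p ((f r - g r) / 2) ((f' r - g' r) / 2) r * r
        \<le> (1 + t) / 2 * ((gradient_term p (f r) (f' r) r + 1 / 2 * (1 - (f r)\<^sup>2)\<^sup>2) * r
          + (gradient_term p (g r) (g' r) r + 1 / 2 * (1 - (g r)\<^sup>2)\<^sup>2) * r) + (1 + 1 / t) / 4 * (((f r)\<^sup>2 - (g r)\<^sup>2)\<^sup>2 / 8 * r)"
      using r unfolding A_def B_def P_def Q_def E_def
      by (simp only: distrib_right distrib_left mult.assoc)
  qed (use \<open>0 < t\<close> in simp_all, measurable)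
  also have "\<dots> \<le> ennreal ((1 + t) * (m + e)) + ennreal ((1 + 1 / t) / 4) * ennreal e"
  proof (intro add_mono mult_left_mono D)
    have "2 * ((1 + t) / 2) * (m + e) = (1 + t) * (m + e)"
      by simp
    then show "ennreal ((1 + t) / 2) * (energy p f f' + energy p g g') \<le> ennreal ((1 + t) * (m + e))"
      using sum[of "(1 + t) / 2"] \<open>0 < t\<close> by (simp only:) simp
  qed simp
  also have "ennreal ((1 + 1 / t) / 4) * ennreal e = ennreal ((1 + 1 / t) / 4 * e)"
    using \<open>0 < t\<close> \<open>0 < e\<close> by (intro ennreal_mult[symmetric]) auto
  also have "ennreal ((1 + t) * (m + e)) + \<dots> = ennreal ((1 + t) * (m + e) + (1 + 1 / t) / 4 * e)"
    using m(1) \<open>0 < t\<close> \<open>0 < e\<close> by (intro ennreal_plus[symmetric]) auto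
  also have "(1 + t) * (m + e) + (1 + 1 / t) / 4 * e = m + (t * (m + e) + e + (1 + 1 / t) * (e / 4))"
    by argo
  also have "ennreal \<dots> = ennreal m + ennreal (t * (m + e) + e + (1 + 1 / t) * (e / 4))"
    using m(1) \<open>0 < t\<close> \<open>0 < e\<close> by (intro ennreal_plus) auto
  finally have "energy p h h' + ?G \<le> ennreal m + ennreal (t * (m + e) + e + (1 + 1 / t) * (e / 4))" .
  moreover have "ennreal m \<le> energy p h h'"
    using m(2)[OF h] by (simp add: h_def f g)
  ultimately have "ennreal m + ?G \<le> ennreal m + ennreal (t * (m + e) + e + (1 + 1 / t) * (e / 4))"
    by (meson add_right_mono order_trans)
  then show ?thesis
    by (simp add: ennreal_add_left_cancel_le)
qed

text \<open>The order of the choices matters: \<open>t\<close> is fixed first to make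
  \<open>t * (m + e)\<close> small, and \<open>e\<close> afterwards, because 1/t multiplies
  \<open>e\<close>.\<close>

lemma exists_energy_tolerance:
  assumes "p > 2" and m: "0 \<le> m" "\<And>f f'. primitive f f' \<Longrightarrow> f 0 = 0 \<Longrightarrow> ennreal m \<le> energy p f f'"
    and "0 < \<tau>"
  shows "\<exists>e>0. \<forall>f f' g g'. primitive f f' \<and> f 0 = 0 \<and> (\<forall>x>0. 0 \<le> f x) \<and> energy p f f' \<le> ennreal (m + e)
      \<and> primitive g g' \<and> g 0 = 0 \<and> (\<forall>x>0. 0 \<le> g x) \<and> energy p g g' \<le> ennreal (m + e)
      \<longrightarrow> gradient_energy p (\<lambda>x. (f x - g x) / 2) (\<lambda>x. (f' x - g' x) / 2) \<le> ennreal \<tau>"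
proof -
  \<comment> \<open>Each of the two errors gets half of the tolerance: e \<le> 1 gives
    \<open>t * (m + e)\<close> \<le> \<open>t * (m + 1)\<close>, and \<open>c\<close> collects the
    coefficients of all remaining terms in \<open>e\<close>.\<close>
  define t where "t = \<tau> / (2 * (m + 1))"
  define c where "c = 1 + (1 + 1 / t) / 4"
  define e where "e = min 1 (\<tau> / (2 * c))"
  have t: "0 < t"
    using \<open>0 < \<tau>\<close> m(1) by (auto simp: t_def intro!: divide_pos_pos)
  have c: "0 < c"
    using t by (auto simp: c_def intro!: add_pos_pos)
  have e: "0 < e"
    using \<open>0 < \<tau>\<close> c by (auto simp: e_def)
  have "t * (m + e) \<le> t * (m + 1)"
    using t by (intro mult_left_mono) (auto simp: e_def)
  also have "\<dots> = \<tau> / 2"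
  proof -
    have "\<tau> / (2 * k) * k = \<tau> / 2" if "k > 0" for k :: real
      using that by simp
    from this[of "m + 1"] show ?thesis
      using m(1) by (simp only: t_def)
  qed
  finally have 1: "t * (m + e) \<le> \<tau> / 2" .
  have "e + (1 + 1 / t) * (e / 4) = c * e"
    unfolding c_def by argo
  also have "\<dots> \<le> c * (\<tau> / (2 * c))"
    using c by (intro mult_left_mono) (auto simp: e_def)
  also have "\<dots> = \<tau> / 2"
    using c by simp
  finally have "t * (m + e) + e + (1 + 1 / t) * (e / 4) \<le> \<tau>"
    using 1 by linarith
  then have le: "ennreal (t * (m + e) + e + (1 + 1 / t) * (e / 4)) \<le> ennreal \<tau>"
    by (rule ennreal_leI)
  show ?thesis
  proof (intro exI[of _ e] conjI e allI impI)
    fix f f' g g' :: "real \<Rightarrow> real"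
    assume "primitive f f' \<and> f 0 = 0 \<and> (\<forall>x>0. 0 \<le> f x) \<and> energy p f f' \<le> ennreal (m + e)
      \<and> primitive g g' \<and> g 0 = 0 \<and> (\<forall>x>0. 0 \<le> g x) \<and> energy p g g' \<le> ennreal (m + e)"
    then show "gradient_energy p (\<lambda>x. (f x - g x) / 2) (\<lambda>x. (f' x - g' x) / 2) \<le> ennreal \<tau>"
      by (intro order_trans[OF gradient_energy_diff_le[OF \<open>p > 2\<close> m] le] t e) auto
  qed
qed

text \<open>The comparison is pointwise: neither the derivative nor the modulus grows, and the
  potential drops to 0 where the modulus exceeds 1. This supplies the nonnegativity needed for
  comparing near-minimisers.\<close>

lemma truncation:
  assumes "p > 2" "primitive f f'" "f 0 = 0"
  shows "\<exists>h h'. primitive h h' \<and> h 0 = 0 \<and> (\<forall>x. 0 \<le> h x \<and> h x \<le> 1) \<and> energy p h h' \<le> energy p f f'"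
proof -
  obtain d where d: "primitive (\<lambda>x. min \<bar>f x\<bar> 1) d" "\<forall>x. \<bar>d x\<bar> \<le> \<bar>f x * f' x / \<bar>f x\<bar>\<bar>"
    using primitive_min_1[OF primitive_abs[OF assms(2)]] by blast
  have d': "\<bar>d x\<bar> \<le> \<bar>f' x\<bar>" for x
    using d(2)[rule_format, of x] by (cases "f x = 0") (auto simp: abs_mult)
  have "energy p (\<lambda>x. min \<bar>f x\<bar> 1) d \<le> energy p f f'"
    unfolding energy_def
  proof (intro nn_integral_mono ennreal_leI mult_right_mono add_mono)
    fix r assume "r \<in> space halfline"
    then show "0 \<le> r" by simp
    have "(d r)\<^sup>2 \<le> (f' r)\<^sup>2"
      using d'[of r] by (simp add: abs_le_square_iff)
    moreover have "(min \<bar>f r\<bar> 1)\<^sup>2 \<le> (f r)\<^sup>2"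
      unfolding abs_le_square_iff[symmetric] by auto
    ultimately show "gradient_term p (min \<bar>f r\<bar> 1) (d r) r \<le> gradient_term p (f r) (f' r) r"
      unfolding gradient_term_def using \<open>p > 2\<close>
      by (intro powr_mono2 add_mono divide_right_mono) auto
    show "1 / 2 * (1 - (min \<bar>f r\<bar> 1)\<^sup>2)\<^sup>2 \<le> 1 / 2 * (1 - (f r)\<^sup>2)\<^sup>2"
      by (cases "\<bar>f r\<bar> \<le> 1") (auto simp: min_def)
  qed
  with d(1) assms(3) show ?thesis
    by (intro exI[of _ "\<lambda>x. min \<bar>f x\<bar> 1"] exI[of _ d]) auto
qed

section \<open>Convergence of minimising sequences\<close>

text \<open>The limit derivative is a telescoping series whose L^1 norms on bounded intervals decay
  geometrically. Absolute summability therefore gives convergence almost everywhere and of the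
  integrals at once, without extracting a subsequence.\<close>

lemma primitive_limit:
  assumes F: "\<And>n. primitive (F n) (F' n)" "\<And>n. F n 0 = 0" and C: "\<And>b. 0 \<le> C b"
    and cauchy: "\<And>n b. 0 \<le> b \<Longrightarrow>
      (\<integral>\<^sup>+ r. ennreal \<bar>F' (Suc n) r - F' n r\<bar> * indicator {..b} r \<partial>halfline) \<le> ennreal (C b * (1 / 2) ^ n)"
  shows "\<exists>f g. primitive f g \<and> f 0 = 0 \<and> (\<forall>x\<ge>0. (\<lambda>n. F n x) \<longlonglongrightarrow> f x)
    \<and> (AE x in halfline. (\<lambda>n. F' n x) \<longlonglongrightarrow> g x)"
proof -
  define D where "D n x = F' (Suc n) x - F' n x" for n x
  define g where "g x = F' 0 x + (\<Sum>n. D n x)" for x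
  define f where "f x = integral {0..x} g" for x
  have tele: "(\<Sum>i<n. D i x) = F' n x - F' 0 x" for n x
    unfolding D_def by (rule sum_lessThan_telescope)
  have ai: "F' n absolutely_integrable_on {0..b}" for n b
    by (rule primitive_absolutely_integrable[OF F(1)])
  have Dai: "D n absolutely_integrable_on {0..b}" for n b
    unfolding D_def by (intro set_integral_diff ai)
  \<comment> \<open>The cut-off omits 0 so that its integrals agree literally with those over the
    open half-line.\<close>
  let ?d = "\<lambda>b n x. indicator {0<..b} x *\<^sub>R D n x"
  have dint: "integrable lebesgue (?d b n)" for b n
    using absolutely_integrable_on_Ioc_iff[THEN iffD2, OF Dai[where n=n and b=b]] by (simp only: set_integrable_def)
  have dint_eq: "integral\<^sup>L lebesgue (?d b n) = integral {0..b} (D n)" for b n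
  proof -
    have "integral\<^sup>L lebesgue (?d b n) = integral {0<..b} (D n)"
      using set_lebesgue_integral_eq_integral(2)[of "{0<..b}" "D n"] Dai[where n=n and b=b]
      by (simp only: absolutely_integrable_on_Ioc_iff set_lebesgue_integral_def)
    also have "\<dots> = integral {0..b} (D n)"
      by (rule integral_subset_negligible) (auto intro: negligible_subset[OF negligible_sing[of 0]])
    finally show ?thesis .
  qed
  have nn: "(\<integral>\<^sup>+ x. ennreal (norm (?d b n x)) \<partial>lebesgue) \<le> ennreal (C b * (1 / 2) ^ n)" if "b \<ge> 0" for b n
    unfolding nn_integral_indicator_Ioc using cauchy[OF that, of n] by (simp only: D_def)
  have em: "(\<lambda>x. ennreal (norm (?d b n x))) \<in> borel_measurable lebesgue" for b n
    by (rule measurable_compose[OF borel_measurable_integrable[OF integrable_norm[OF dint]] measurable_ennreal])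
  have geo: "summable (\<lambda>n. C b * (1 / 2) ^ n)" for b
    by (intro summable_mult summable_geometric) simp
  have AE_sum: "AE x in lebesgue. summable (\<lambda>n. norm (?d b n x))" if "b \<ge> 0" for b
  proof -
    have "(\<integral>\<^sup>+ x. (\<Sum>n. ennreal (norm (?d b n x))) \<partial>lebesgue) = (\<Sum>n. \<integral>\<^sup>+ x. ennreal (norm (?d b n x)) \<partial>lebesgue)"
      by (rule nn_integral_suminf[OF em])
    also have "\<dots> \<le> (\<Sum>n. ennreal (C b * (1 / 2) ^ n))"
      by (intro suminf_le nn that summableI)
    also have "\<dots> = ennreal (\<Sum>n. C b * (1 / 2) ^ n)"
      using C geo by (intro suminf_ennreal2) auto
    also have "\<dots> < \<infinity>"
      by simp
    finally have "AE x in lebesgue. (\<Sum>n. ennreal (norm (?d b n x))) \<noteq> \<infinity>"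
      by (intro nn_integral_noteq_infinite borel_measurable_suminf_order em) auto
    then show ?thesis
      by eventually_elim (auto intro: summable_suminf_not_top)
  qed
  have sum_int: "summable (\<lambda>n. integral\<^sup>L lebesgue (\<lambda>x. norm (?d b n x)))" if "b \<ge> 0" for b
  proof (rule summable_comparison_test[OF _ geo[of b]], intro exI allI impI)
    fix n
    have "ennreal (integral\<^sup>L lebesgue (\<lambda>x. norm (?d b n x))) \<le> ennreal (C b * (1 / 2) ^ n)"
      using nn[OF that, of n] nn_integral_eq_integral[OF integrable_norm[OF dint[of b n]]] by simp
    then show "norm (integral\<^sup>L lebesgue (\<lambda>x. norm (?d b n x))) \<le> C b * (1 / 2) ^ n"
      using C by (simp add: ennreal_le_iff)
  qed
  have gai: "g absolutely_integrable_on {0..b}" 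
    and glim: "(\<lambda>n. integral {0..b} (F' n)) \<longlonglongrightarrow> integral {0..b} g" if "b \<ge> 0" for b
  proof -
    let ?S = "\<lambda>x. \<Sum>n. D n x"
    have sumeq: "(\<Sum>n. ?d b n x) = indicator {0<..b} x *\<^sub>R ?S x" for x
      by (cases "x \<in> {0<..b}") auto
    have "integrable lebesgue (\<lambda>x. \<Sum>n. ?d b n x)"
      by (rule integrable_suminf[OF dint AE_sum[OF that] sum_int[OF that]])
    then have "?S absolutely_integrable_on {0<..b}"
      by (simp only: sumeq set_integrable_def)
    then have S: "?S absolutely_integrable_on {0..b}"
      by (simp only: absolutely_integrable_on_Ioc_iff)
    then show gai: "g absolutely_integrable_on {0..b}"
      unfolding g_def[abs_def] by (intro set_integral_add ai)
    have "(\<lambda>n. integral\<^sup>L lebesgue (?d b n)) sums (integral\<^sup>L lebesgue (\<lambda>x. \<Sum>n. ?d b n x))"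
      by (rule sums_integral[OF dint AE_sum[OF that] sum_int[OF that]])
    moreover have "integral\<^sup>L lebesgue (\<lambda>x. \<Sum>n. ?d b n x) = integral {0..b} ?S"
    proof -
      have "integral\<^sup>L lebesgue (\<lambda>x. \<Sum>n. ?d b n x) = integral {0<..b} ?S"
        using set_lebesgue_integral_eq_integral(2)[of "{0<..b}" ?S] S
        by (simp only: absolutely_integrable_on_Ioc_iff set_lebesgue_integral_def sumeq)
      also have "\<dots> = integral {0..b} ?S"
        by (rule integral_subset_negligible) (auto intro: negligible_subset[OF negligible_sing[of 0]])
      finally show ?thesis .
    qed
    ultimately have "(\<lambda>n. \<Sum>i<n. integral {0..b} (D i)) \<longlonglongrightarrow> integral {0..b} ?S"
      by (simp only: sums_def dint_eq)
    moreover have "(\<Sum>i<n. integral {0..b} (D i)) = integral {0..b} (F' n) - integral {0..b} (F' 0)" for n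
    proof -
      have "integral {0..b} (D i) = integral {0..b} (F' (Suc i)) - integral {0..b} (F' i)" for i
        unfolding D_def by (intro integral_diff primitive_integrable[OF F(1)])
      then show ?thesis
        using sum_lessThan_telescope[of "\<lambda>i. integral {0..b} (F' i)" n] by (simp only:)
    qed
    ultimately have "(\<lambda>n. integral {0..b} (F' n) - integral {0..b} (F' 0)) \<longlonglongrightarrow> integral {0..b} ?S"
      by simp
    then have "(\<lambda>n. integral {0..b} (F' 0) + (integral {0..b} (F' n) - integral {0..b} (F' 0)))
        \<longlonglongrightarrow> integral {0..b} (F' 0) + integral {0..b} ?S"
      by (intro tendsto_add tendsto_const)
    moreover have "integral {0..b} g = integral {0..b} (F' 0) + integral {0..b} ?S"
      unfolding g_def[abs_def]
      by (intro integral_add primitive_integrable[OF F(1)] set_lebesgue_integral_eq_integral(1)[OF S])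
    ultimately show "(\<lambda>n. integral {0..b} (F' n)) \<longlonglongrightarrow> integral {0..b} g"
      by simp
  qed
  have prim: "primitive f g"
    unfolding primitive_def f_def
  proof (intro conjI allI impI)
    show "g absolutely_integrable_on {0..b}" for b
      using gai[of b] by (cases "b \<ge> 0") auto
  qed simp
  moreover have "(\<lambda>n. F n x) \<longlonglongrightarrow> f x" if "x \<ge> 0" for x
  proof -
    have "F n x = integral {0..x} (F' n)" for n
      using primitive_eq[OF F(1) that, of n] F(2)[of n] by simp
    then show ?thesis
      using glim[OF that] by (simp add: f_def)
  qed
  moreover have "AE x in halfline. (\<lambda>n. F' n x) \<longlonglongrightarrow> g x"
  proof -
    \<comment> \<open>The exceptional null set depends on the cut-off, so only countably many
      cut-offs may be used; integer ones suffice.\<close>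
    have "AE x in lebesgue. \<forall>k. summable (\<lambda>n. norm (?d (real k) n x))"
      unfolding AE_all_countable by (intro allI AE_sum) simp
    then show ?thesis
      unfolding AE_halfline_iff
    proof eventually_elim
      case (elim x)
      show ?case
      proof
        assume "x > 0"
        obtain k :: nat where "x \<le> k"
          using real_arch_simple by blast
        then have eq: "?d (real k) n x = D n x" for n
          using \<open>x > 0\<close> by simp
        have "summable (\<lambda>n. norm (D n x))"
          using elim[rule_format, of k] by (simp only: eq)
        then have "(\<lambda>n. D n x) sums (\<Sum>n. D n x)"
          by (rule summable_sums[OF summable_norm_cancel])
        then have "(\<lambda>n. F' n x - F' 0 x) \<longlonglongrightarrow> (\<Sum>n. D n x)"
          by (simp only: sums_def tele)
        then have "(\<lambda>n. F' 0 x + (F' n x - F' 0 x)) \<longlonglongrightarrow> F' 0 x + (\<Sum>n. D n x)"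
          by (intro tendsto_add tendsto_const)
        then show "(\<lambda>n. F' n x) \<longlonglongrightarrow> g x"
          by (simp add: g_def)
      qed
    qed
  qed
  moreover have "f 0 = 0"
    by (simp add: f_def)
  ultimately show ?thesis
    by blast
qed

lemma energy_lower_semicontinuous:
  assumes "p > 2" and F: "\<And>n. primitive (F n) (F' n)" and fg: "primitive f g"
    and "\<And>x. x > 0 \<Longrightarrow> (\<lambda>n. F n x) \<longlonglongrightarrow> f x"
    and "AE x in halfline. (\<lambda>n. F' n x) \<longlonglongrightarrow> g x"
  shows "energy p f g \<le> liminf (\<lambda>n. energy p (F n) (F' n))"
proof -
  let ?e = "\<lambda>u v r. ennreal ((gradient_term p (u r) (v r) r + 1 / 2 * (1 - (u r)\<^sup>2)\<^sup>2) * r)"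
  note [measurable] = primitive_measurable[OF F]
  have pos: "AE r in halfline. r > 0"
    by (simp add: AE_halfline_iff)
  have "energy p f g = (\<integral>\<^sup>+ r. liminf (\<lambda>n. ?e (F n) (F' n) r) \<partial>halfline)"
    unfolding energy_def
  proof (rule nn_integral_cong_AE)
    show "AE r in halfline. ?e f g r = liminf (\<lambda>n. ?e (F n) (F' n) r)"
      using assms(5) pos
    proof eventually_elim
      case (elim r)
      note lim = assms(4)[OF elim(2)] elim(1)
      have "(\<lambda>n. gradient_term p (F n r) (F' n r) r) \<longlonglongrightarrow> gradient_term p (f r) (g r) r"
        unfolding gradient_term_def using \<open>p > 2\<close> elim(2)
        by (intro tendsto_powr' tendsto_intros lim) auto
      then have "(\<lambda>n. ?e (F n) (F' n) r) \<longlonglongrightarrow> ?e f g r"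
        by (intro tendsto_ennrealI tendsto_mult tendsto_add tendsto_power tendsto_diff tendsto_const lim)
      then show ?case
        by (intro lim_imp_Liminf[symmetric]) auto
    qed
  qed
  also have "\<dots> \<le> liminf (\<lambda>n. energy p (F n) (F' n))"
    unfolding energy_def by (rule nn_integral_liminf) measurable
  finally show ?thesis .
qed

lemma exists_energy_minimizer:
  assumes "p > 2" and m: "0 \<le> m" "\<And>f f'. primitive f f' \<Longrightarrow> f 0 = 0 \<Longrightarrow> ennreal m \<le> energy p f f'"
    and approx: "\<And>e. 0 < e \<Longrightarrow> \<exists>f f'. primitive f f' \<and> f 0 = 0 \<and> energy p f f' \<le> ennreal (m + e)"
  shows "\<exists>f g. primitive f g \<and> f 0 = 0 \<and> (\<forall>x\<ge>0. 0 \<le> f x \<and> f x \<le> 1) \<and> energy p f g \<le> ennreal m"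
proof -
  define l :: "nat \<Rightarrow> real" where "l n = (1 / 2) ^ n" for n
  have l: "0 < l n" for n
    by (simp add: l_def)
  \<comment> \<open>The tolerance is a p-th power because \<open>young_integral_bound\<close> with
    scale \<open>l n\<close> then returns a bound linear in \<open>l n\<close>.\<close>
  have "\<forall>n. \<exists>e>0. \<forall>f f' g g'. primitive f f' \<and> f 0 = 0 \<and> (\<forall>x>0. 0 \<le> f x) \<and> energy p f f' \<le> ennreal (m + e)
      \<and> primitive g g' \<and> g 0 = 0 \<and> (\<forall>x>0. 0 \<le> g x) \<and> energy p g g' \<le> ennreal (m + e)
      \<longrightarrow> gradient_energy p (\<lambda>x. (f x - g x) / 2) (\<lambda>x. (f' x - g' x) / 2) \<le> ennreal (l n powr p)"
    using less_imp_neq[OF l, symmetric] by (intro allI exists_energy_tolerance \<open>p > 2\<close> m) simp_all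
  then obtain e where e: "\<And>n. 0 < e n"
    "\<And>n f f' g g'. primitive f f' \<and> f 0 = 0 \<and> (\<forall>x>0. 0 \<le> f x) \<and> energy p f f' \<le> ennreal (m + e n)
      \<and> primitive g g' \<and> g 0 = 0 \<and> (\<forall>x>0. 0 \<le> g x) \<and> energy p g g' \<le> ennreal (m + e n)
      \<Longrightarrow> gradient_energy p (\<lambda>x. (f x - g x) / 2) (\<lambda>x. (f' x - g' x) / 2) \<le> ennreal (l n powr p)"
    unfolding choice_iff by blast
  \<comment> \<open>The minimum over all earlier tolerances makes both the n-th and the next
    near-minimiser meet the tolerance \<open>e n\<close>; the term \<open>l n\<close> forces the
    energies down to m.\<close>
  define \<delta> where "\<delta> n = Min (insert (l n) (e ` {..n}))" for n
  have \<delta>: "0 < \<delta> n" "\<delta> n \<le> l n" "\<delta> n \<le> e n" "\<delta> (Suc n) \<le> e n" for n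
  proof -
    show "0 < \<delta> n"
      unfolding \<delta>_def using e(1) l by (subst Min_gr_iff) auto
    show "\<delta> n \<le> l n" "\<delta> n \<le> e n" "\<delta> (Suc n) \<le> e n"
      unfolding \<delta>_def by (rule Min_le; simp)+
  qed
  have "\<exists>f f'. primitive f f' \<and> f 0 = 0 \<and> (\<forall>x. 0 \<le> f x \<and> f x \<le> 1) \<and> energy p f f' \<le> ennreal (m + \<delta> n)" for n
  proof -
    obtain f f' where f: "primitive f f'" "f 0 = 0" "energy p f f' \<le> ennreal (m + \<delta> n)"
      using approx[OF \<delta>(1)] by blast
    obtain h h' where "primitive h h'" "h 0 = 0" "\<forall>x. 0 \<le> h x \<and> h x \<le> 1" "energy p h h' \<le> energy p f f'"
      using truncation[OF \<open>p > 2\<close> f(1,2)] by blast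
    with f(3) show ?thesis
      by (intro exI[of _ h] exI[of _ h']) auto
  qed
  then have "\<forall>n. \<exists>u. primitive (fst u) (snd u) \<and> fst u 0 = 0 \<and> (\<forall>x. 0 \<le> fst u x \<and> fst u x \<le> 1)
      \<and> energy p (fst u) (snd u) \<le> ennreal (m + \<delta> n)"
    by simp
  then obtain U where U: "\<forall>n. primitive (fst (U n)) (snd (U n)) \<and> fst (U n) 0 = 0 \<and> (\<forall>x. 0 \<le> fst (U n) x \<and> fst (U n) x \<le> 1)
      \<and> energy p (fst (U n)) (snd (U n)) \<le> ennreal (m + \<delta> n)"
    unfolding choice_iff by blast
  define F where "F n = fst (U n)" for n
  define F' where "F' n = snd (U n)" for n
  have F: "primitive (F n) (F' n)" "F n 0 = 0" "0 \<le> F n x" "F n x \<le> 1" "energy p (F n) (F' n) \<le> ennreal (m + \<delta> n)" for n x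
    using U by (auto simp: F_def F'_def)
  have Fe: "energy p (F n) (F' n) \<le> ennreal (m + e n)" "energy p (F (Suc n)) (F' (Suc n)) \<le> ennreal (m + e n)" for n
    using \<delta>[of n] by (auto intro!: order_trans[OF F(5)] ennreal_leI)
  have cauchy: "(\<integral>\<^sup>+ r. ennreal \<bar>F' (Suc n) r - F' n r\<bar> * indicator {..b} r \<partial>halfline)
      \<le> ennreal (2 * (young_const p b + 1) * (1 / 2) ^ n)" if "0 \<le> b" for n b
  proof -
    define d where "d r = (F' (Suc n) r - F' n r) / 2" for r
    note [measurable] = primitive_measurable(2)[OF F(1)]
    have [measurable]: "d \<in> borel_measurable halfline"
      unfolding d_def by measurable
    have [measurable]: "indicator {..b} \<in> borel_measurable halfline"
      by (rule measurable_restrict_space1, rule measurable_completion) simp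
    have "(\<integral>\<^sup>+ r. ennreal (\<bar>d r\<bar> powr p * r) \<partial>halfline)
        \<le> gradient_energy p (\<lambda>x. (F (Suc n) x - F n x) / 2) (\<lambda>x. (F' (Suc n) x - F' n x) / 2)"
      unfolding gradient_energy_def d_def
      using \<open>p > 2\<close> by (intro nn_integral_mono ennreal_leI mult_right_mono powr_le_gradient_term) auto
    also have "\<dots> \<le> ennreal (l n powr p)"
      by (rule e(2)) (use F Fe in auto)
    finally have "(\<integral>\<^sup>+ r. ennreal \<bar>d r\<bar> * indicator {..b} r \<partial>halfline)
        \<le> ennreal (l n * young_const p b) + ennreal (l n powr (1 - p)) * ennreal (l n powr p)"
      by (intro order_trans[OF young_integral_bound[OF _ \<open>p > 2\<close> l[of n] that]] add_left_mono mult_left_mono) auto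
    \<comment> \<open>Here the two powers of the scale combine to the first power, which makes the
      increments summable.\<close>
    also have "ennreal (l n powr (1 - p)) * ennreal (l n powr p) = ennreal (l n)"
      using l[of n] by (simp flip: ennreal_mult powr_add)
    also have "ennreal (l n * young_const p b) + ennreal (l n) = ennreal (l n * (young_const p b + 1))"
      using l[of n] young_const_nonneg[OF \<open>p > 2\<close>, of b]
      by (subst ennreal_plus[symmetric]) (simp_all add: distrib_left)
    finally have le: "(\<integral>\<^sup>+ r. ennreal \<bar>d r\<bar> * indicator {..b} r \<partial>halfline) \<le> ennreal (l n * (young_const p b + 1))" .
    have "(\<integral>\<^sup>+ r. ennreal \<bar>F' (Suc n) r - F' n r\<bar> * indicator {..b} r \<partial>halfline)
        = (\<integral>\<^sup>+ r. ennreal 2 * (ennreal \<bar>d r\<bar> * indicator {..b} r) \<partial>halfline)"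
    proof (rule nn_integral_cong)
      fix r
      have "\<bar>F' (Suc n) r - F' n r\<bar> = 2 * \<bar>d r\<bar>"
        by (simp add: d_def)
      then show "ennreal \<bar>F' (Suc n) r - F' n r\<bar> * indicator {..b} r = ennreal 2 * (ennreal \<bar>d r\<bar> * indicator {..b} r)"
        by (simp only: ennreal_mult[OF zero_le_numeral abs_ge_zero] mult.assoc)
    qed
    also have "\<dots> = ennreal 2 * (\<integral>\<^sup>+ r. ennreal \<bar>d r\<bar> * indicator {..b} r \<partial>halfline)"
      by (rule nn_integral_cmult) measurable
    also have "\<dots> \<le> ennreal 2 * ennreal (l n * (young_const p b + 1))"
      by (intro mult_left_mono le) simp
    also have "\<dots> = ennreal (2 * (young_const p b + 1) * (1 / 2) ^ n)"
      using young_const_nonneg[OF \<open>p > 2\<close>, of b] l[of n]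
      by (subst ennreal_mult[symmetric]) (simp_all add: l_def mult_ac)
    finally show ?thesis .
  qed
  have C: "0 \<le> 2 * (young_const p b + 1)" for b
    using young_const_nonneg[OF \<open>p > 2\<close>, of b] by simp
  obtain f g where fg: "primitive f g" "f 0 = 0" "\<forall>x\<ge>0. (\<lambda>n. F n x) \<longlonglongrightarrow> f x"
    "AE x in halfline. (\<lambda>n. F' n x) \<longlonglongrightarrow> g x"
    using primitive_limit[of F F' "\<lambda>b. 2 * (young_const p b + 1)", OF F(1,2) C cauchy] by blast
  have "energy p f g \<le> liminf (\<lambda>n. energy p (F n) (F' n))"
    using fg by (intro energy_lower_semicontinuous \<open>p > 2\<close> F(1)) auto
  also have "\<dots> \<le> liminf (\<lambda>n. ennreal (m + l n))"
    using \<delta>(2) by (intro Liminf_mono always_eventually allI order_trans[OF F(5)] ennreal_leI add_left_mono)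
  also have "\<dots> = ennreal m"
  proof (rule lim_imp_Liminf)
    have "l \<longlonglongrightarrow> 0"
      unfolding l_def[abs_def] by (rule LIMSEQ_realpow_zero) auto
    then have "(\<lambda>n. m + l n) \<longlonglongrightarrow> m + 0"
      by (intro tendsto_add tendsto_const)
    then show "(\<lambda>n. ennreal (m + l n)) \<longlonglongrightarrow> ennreal m"
      by (intro tendsto_ennrealI) simp
  qed simp
  finally have "energy p f g \<le> ennreal m" .
  moreover have "0 \<le> f x \<and> f x \<le> 1" if "x \<ge> 0" for x
    using fg(3)[rule_format, OF that] F(3,4)
    by (auto intro: LIMSEQ_le_const LIMSEQ_le_const2)
  ultimately show ?thesis
    using fg(1,2) by blast
qed

text \<open>The minimiser is delivered as its continuous representative, which gives meaning to
  bounds at every point of [0, \<infinity>).\<close>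

theorem proposition2p1:
  fixes p :: real
  assumes "p > 2"
  shows "\<exists>f \<in> X p.
           (\<forall>h \<in> X p. I p f \<le> I p h) \<and>
           continuous_on {0..} f \<and> f 0 = 0 \<and>
           (\<forall>r \<ge> 0. 0 \<le> f r \<and> f r \<le> 1)"
proof -
  \<comment> \<open>The infimum is taken over pairs instead of \<open>X p\<close>: every value of
    the functional on \<open>X p\<close> occurs in \<open>A\<close>, and the minimising pair found
    below is returned to \<open>X p\<close> by \<open>primitive_in_X\<close>.\<close>
  define A where "A = {energy p f f' |f f'. primitive f f' \<and> f 0 = 0}"
  have below: "Inf A \<le> I p h" if h: "h \<in> X p" for h
  proof -
    obtain f g where "primitive f g" "f 0 = 0" "energy p f g = I p h"
      using X_obtains_primitive[OF assms h] by blast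
    then have "I p h \<in> A"
      unfolding A_def by force
    then show ?thesis
      by (rule Inf_lower)
  qed
  obtain f g where fg: "primitive f g" "f 0 = 0" "\<forall>x\<ge>0. 0 \<le> f x \<and> f x \<le> 1"
    "gradient_energy p f g < \<infinity>" "energy p f g \<le> Inf A"
  proof (cases "Inf A = \<infinity>")
    case True \<comment> \<open>This case does not occur, but it is easier to handle than to exclude.\<close>
    have "gradient_energy p (\<lambda>x. 0) (\<lambda>x. 0) < \<infinity>"
      using assms by (simp add: gradient_energy_def gradient_term_def)
    moreover have "energy p (\<lambda>x. 0) (\<lambda>x. 0) \<le> Inf A"
      unfolding True by simp
    ultimately show ?thesis
      by (intro that[OF primitive_const[of 0]]) auto
  next
    case False
    define m where "m = enn2real (Inf A)"
    have "Inf A < top"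
      using False by (simp only: less_top[symmetric] infinity_ennreal_def not_False_eq_True)
    then have m: "ennreal m = Inf A" "0 \<le> m"
      unfolding m_def by (simp_all only: ennreal_enn2real enn2real_nonneg)
    have lower: "ennreal m \<le> energy p f f'" if "primitive f f'" "f 0 = 0" for f f'
      unfolding m(1) by (rule Inf_lower) (use that A_def in auto)
    have approx: "\<exists>f f'. primitive f f' \<and> f 0 = 0 \<and> energy p f f' \<le> ennreal (m + e)" if "0 < e" for e
    proof -
      have "Inf A < ennreal (m + e)"
        unfolding m(1)[symmetric] using m(2) that by (intro ennreal_lessI) auto
      then obtain a where "a \<in> A" "a < ennreal (m + e)"
        unfolding Inf_less_iff by blast
      then show ?thesis
        unfolding A_def by (auto intro: less_imp_le)
    qed
    obtain f g where f: "primitive f g" "f 0 = 0" "\<forall>x\<ge>0. 0 \<le> f x \<and> f x \<le> 1" "energy p f g \<le> ennreal m"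
      using exists_energy_minimizer[OF assms m(2) lower approx] by blast
    \<comment> \<open>Membership in \<open>X p\<close> needs only the gradient part to be finite,
      and the energy bounds it.\<close>
    have "gradient_energy p f g \<le> ennreal m"
      using gradient_energy_le_energy f(4) by (rule order_trans)
    then have "gradient_energy p f g < \<infinity>"
      by (rule le_less_trans) simp
    then show ?thesis
      using f unfolding m(1) by (intro that[of f g]) auto
  qed
  note X = primitive_in_X[OF assms fg(1,4)]
  show ?thesis
  proof (intro bexI[OF _ X(1)] conjI ballI)
    show "I p f \<le> I p h" if "h \<in> X p" for h
      unfolding X(2) using fg(5) below[OF that] by (rule order_trans)
    show "continuous_on {0..} f"
      using fg(1) by (rule primitive_continuous_on)
  qed (use fg in auto)
qed

end
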